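(* For any $C>0$, the map $\mathcal{W}:\tilde A_C\to BV(B_{\tilde R})$ is uniformly continuous with respect to the $L^1$ norm on $\tilde A_C$ and the distance $d_{st}$ on $BV(B_{\tilde R})$.
   Context: $B_\rho$ is the open ball in $\mathbb{R}^2$ of radius $\rho$ centered at $0$. Fix $R>0$ and $0<\alpha\le 1$. Optical data: $K:\mathbb{R}^2\to\mathbb{C}$ belongs to $C^{1,\alpha}(\mathbb{R}^2)$ and $|K(x)|\to 0$ uniformly as $\|x\|\to+\infty$; $J:\mathbb{R}^2\to\mathbb{C}$ is the Fourier transform of an a.e. nonnegative function in $L^1(\mathbb{R}^2)$ (so $J$ is continuous). $A=\{u\in L^1(\mathbb{R}^2): 0\le u\le 1 \text{ a.e. in }\mathbb{R}^2,\ u=0\text{ a.e. outside }B_R\}$, and for $u\in A$ $$\mathcal{I}(u)(x)=\int_{\mathbb{R}^2}\int_{\mathbb{R}^2}u(\xi)K(x-\xi)J(\xi-\eta)\overline{K}(x-\eta)u(\eta)\,d\xi\,d\eta,\quad x\in\mathbb{R}^2 ,$$ which is real-valued, nonnegative and $C^{1,\alpha}$. Fix a threshold $h>0$ and, for $u\in A$, let $\mathcal{W}(u)=\chi_{\Omega(u)}$, where $\Omega(u)=\{x\in\mathbb{R}^2:\mathcal{I}(u)(x)>h\}$. Regularization term: fix $\delta_0>0$. Let $f:\mathbb{R}\to[0,+\infty]$ be continuous, decreasing (in the wide sense), $f\equiv+\infty$ on $(-\infty,0]$, $f\equiv 0$ on $[\delta_0,+\infty)$, and $\lim_{s\to0^+}f(s)s^{2/\alpha}\ge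 C_0>0$ for some constant $C_0$. Let $\varphi:\mathbb{R}\to\mathbb{R}$ be $C^1$, with $\varphi(h)>0$, increasing before $h$ and decreasing after $h$, and $\varphi(0)<-\delta_0$. Fix $\delta,c_1>0$ such that $\varphi\ge c_1$ on $[h-\delta,h+\delta]$ and $\varphi(0)\le-(\delta_0+\delta)$. Set $$\mathcal{R}(u)=\int_{\mathbb{R}^2}f\big(\|\nabla(\mathcal{I}(u))\|^2-\varphi(\mathcal{I}(u))\big)\,dx\in[0,+\infty],\quad u\in A,$$ and, for $C>0$, $\tilde A_C=\{u\in A:\mathcal{R}(u)\le C\}$. Fix $R_1\ge R$ such that, for all $u\in A$, $\{\mathcal{I}(u)\ge h-\delta\}\subset B_{R_1}$ and $\|\nabla\mathcal{I}(u)(x)\|^2-\varphi(\mathcal{I}(u)(x))\ge\delta_0$ whenever $\|x\|\ge R_1$ (such $R_1$ exists by uniform decay of $\mathcal{I}(u)$), and let $\tilde R=R_1+1$. Fix a constant $a>0$. For $v,w\in BV(B_{\tilde R})$, $$d_{st}(v,w)=\int_{B_{\tilde R}}|v-w|+a\big||Dv|(B_{\tilde R})-|Dw|(B_{\tilde R})\big| .$$ *)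

theory Defs
  imports "HOL-Analysis.Analysis"
begin

section \<open>Differential calculus on the plane\<close>

definition gradient :: "('a::real_inner \<Rightarrow> real) \<Rightarrow> 'a \<Rightarrow> 'a" where
  "gradient F x = (THE D. GDERIV F x :> D)"

definition divergence :: "('a::euclidean_space \<Rightarrow> 'a) \<Rightarrow> 'a \<Rightarrow> real" where
  "divergence T x = (\<Sum>b\<in>Basis. frechet_derivative T (at x) b \<bullet> b)"

text \<open>The space \<open>C\<^sup>1\<^sup>,\<^sup>\<alpha>\<close> on the whole space: finite global norm
  \<open>sup |F| + sup |DF| + [DF]\<^sub>\<alpha>\<close>.\<close>

definition C1_hoelder :: "real \<Rightarrow> ('a::real_normed_vector \<Rightarrow> 'b::real_normed_vector) \<Rightarrow> bool" where
  "C1_hoelder \<alpha> F \<longleftrightarrow>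
     (\<exists>F' :: 'a \<Rightarrow> 'a \<Rightarrow>\<^sub>L 'b.
        (\<forall>x. (F has_derivative blinfun_apply (F' x)) (at x)) \<and>
        bounded (range F) \<and> bounded (range F') \<and>
        (\<exists>H. \<forall>x y. norm (F' x - F' y) \<le> H * norm (x - y) powr \<alpha>))"


section \<open>Functions of bounded variation\<close>

definition C1_test_fields :: "'a::euclidean_space set \<Rightarrow> ('a \<Rightarrow> 'a) set" where
  "C1_test_fields B =
     {T. (\<exists>T' :: 'a \<Rightarrow> 'a \<Rightarrow>\<^sub>L 'a.
            (\<forall>x. (T has_derivative blinfun_apply (T' x)) (at x)) \<and> continuous_on UNIV T') \<and>
         compact (closure {x. T x \<noteq> 0}) \<and> closure {x. T x \<noteq> 0} \<subseteq> B}"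

text \<open>\<open>|Dv|(B)\<close> for \<open>B\<close> open and \<open>v\<close> integrable on \<open>B\<close>.\<close>

definition total_variation :: "'a::euclidean_space set \<Rightarrow> ('a \<Rightarrow> real) \<Rightarrow> ereal" where
  "total_variation B v =
     (SUP T \<in> {T \<in> C1_test_fields B. \<forall>x. norm (T x) \<le> 1}.
        ereal (LINT x:B|lebesgue. v x * divergence T x))"

text \<open>Elements of \<open>L\<^sup>1\<close> and of \<open>BV\<close> are represented by functions rather than by
  classes modulo almost-everywhere equality; all the quantities below depend on the class only.\<close>

definition BV :: "'a::euclidean_space set \<Rightarrow> ('a \<Rightarrow> real) set" where
  "BV B = {v. set_integrable lebesgue B v \<and> total_variation B v < \<infinity>}"

definition d_st :: "real \<Rightarrow> 'a::euclidean_space set \<Rightarrow> ('a \<Rightarrow> real) \<Rightarrow> ('a \<Rightarrow> real) \<Rightarrow> real" where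
  "d_st a B v w =
     (LINT x:B|lebesgue. \<bar>v x - w x\<bar>) +
     a * \<bar>real_of_ereal (total_variation B v) - real_of_ereal (total_variation B w)\<bar>"

definition L1_dist :: "('a::euclidean_space \<Rightarrow> real) \<Rightarrow> ('a \<Rightarrow> real) \<Rightarrow> real" where
  "L1_dist u v = (LINT x|lebesgue. \<bar>u x - v x\<bar>)"


section \<open>The optical model\<close>

text \<open>Another normalisation of the Fourier transform only replaces \<open>g\<close> by a positive multiple
  of a (possibly reflected) dilation of \<open>g\<close>, so it gives the same class of kernels \<open>J\<close>.\<close>

definition fourier_transform :: "('a::euclidean_space \<Rightarrow> real) \<Rightarrow> 'a \<Rightarrow> complex" where
  "fourier_transform g x =
     (LINT y|lebesgue. exp (- (\<i> * complex_of_real (x \<bullet> y))) * complex_of_real (g y))"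

definition masks :: "real \<Rightarrow> (real^2 \<Rightarrow> real) set" where
  "masks R =
     {u. integrable lebesgue u \<and>
         (AE x in lebesgue. 0 \<le> u x \<and> u x \<le> 1) \<and>
         (AE x in lebesgue. x \<notin> ball 0 R \<longrightarrow> u x = 0)}"

text \<open>If \<open>J\<close> is the Fourier transform of a nonnegative integrable function, then
  \<open>J (- x) = cnj (J x)\<close>, so the double integral is real and \<open>Re\<close> merely changes its type.\<close>

definition intensity ::
  "(real^2 \<Rightarrow> complex) \<Rightarrow> (real^2 \<Rightarrow> complex) \<Rightarrow> (real^2 \<Rightarrow> real) \<Rightarrow> real^2 \<Rightarrow> real" where
  "intensity K J u x =
     Re (LINT \<eta>|lebesgue. LINT \<xi>|lebesgue.
           complex_of_real (u \<xi>) * K (x - \<xi>) * J (\<xi> - \<eta>) * cnj (K (x - \<eta>)) * complex_of_real (u \<eta>))"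

definition exposed ::
  "(real^2 \<Rightarrow> complex) \<Rightarrow> (real^2 \<Rightarrow> complex) \<Rightarrow> real \<Rightarrow> (real^2 \<Rightarrow> real) \<Rightarrow> (real^2) set" where
  "exposed K J h u = {x. intensity K J u x > h}"

definition wafer ::
  "(real^2 \<Rightarrow> complex) \<Rightarrow> (real^2 \<Rightarrow> complex) \<Rightarrow> real \<Rightarrow> (real^2 \<Rightarrow> real) \<Rightarrow> real^2 \<Rightarrow> real" where
  "wafer K J h u = indicator (exposed K J h u)"

definition regularizer ::
  "(real^2 \<Rightarrow> complex) \<Rightarrow> (real^2 \<Rightarrow> complex) \<Rightarrow> (real \<Rightarrow> ennreal) \<Rightarrow> (real \<Rightarrow> real) \<Rightarrow>
     (real^2 \<Rightarrow> real) \<Rightarrow> ennreal" where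
  "regularizer K J f \<phi> u =
     (\<integral>\<^sup>+ x. f ((norm (gradient (intensity K J u) x))\<^sup>2 - \<phi> (intensity K J u x)) \<partial>lebesgue)"

definition regular_masks ::
  "real \<Rightarrow> (real^2 \<Rightarrow> complex) \<Rightarrow> (real^2 \<Rightarrow> complex) \<Rightarrow> (real \<Rightarrow> ennreal) \<Rightarrow> (real \<Rightarrow> real) \<Rightarrow>
     real \<Rightarrow> (real^2 \<Rightarrow> real) set" where
  "regular_masks R K J f \<phi> C = {u \<in> masks R. regularizer K J f \<phi> u \<le> ennreal C}"

end

theory Submission
  imports Defs
begin

text \<open>
  Write \<open>F = \<I>(u)\<close>. The theorem follows from three facts about the family of all such \<open>F\<close>.

  \<^item> \<^emph>\<open>Uniform regularity.\<close> \<open>F x\<close> is a bounded quadratic form, depending on \<open>u\<close>, evaluated at the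
    translated kernel \<open>K (x - \<cdot>)\<close>; and \<open>x \<mapsto> K (x - \<cdot>)\<close> is a \<open>C\<^sup>1\<^sup>,\<^sup>\<alpha>\<close> map into the Banach space of
    bounded continuous functions (\<open>C1_hoelder_translates\<close>). So the gradients of all the \<open>F\<close> have
    a common bound and a common modulus of continuity (\<open>imaged_gradient\<close>), and the sup distance
    of \<open>\<I>(u)\<close> and \<open>\<I>(v)\<close> is at most a constant times the \<open>L\<^sup>1\<close> distance of \<open>u\<close> and \<open>v\<close>
    (\<open>imaging_form_diff_mask\<close>).

  \<^item> \<^emph>\<open>Nondegeneracy.\<close> If \<open>\<parallel>\<nabla>F\<parallel>\<^sup>2 < \<phi>(F)\<close> at one point, then also in a neighbourhood
    of it, where the integrand of the regularizer would be infinite. Hence \<open>\<parallel>\<nabla>F\<parallel>\<^sup>2 \<ge> \<phi>(F)\<close> everywhere,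
    and \<open>\<parallel>\<nabla>F\<parallel> \<ge> \<surd>c\<^sub>1\<close> wherever \<open>\<bar>F - h\<bar> \<le> \<delta>\<close>.

  \<^item> \<^emph>\<open>Strict stability of superlevel sets\<close> for any family with these properties
    (\<open>superlevel_sets_strictly_stable\<close>). For every \<open>0 < k \<le> 1\<close> each \<open>F\<close> has a test field \<open>T\<close> with
    \<open>\<parallel>T\<parallel> \<le> 1\<close> that points along \<open>- \<nabla>F\<close> near the level \<open>h\<close> up to the relative error \<open>k\<close>, and
    with \<open>\<bar>div T\<bar> \<le> D\<close>, where \<open>D\<close> depends on \<open>k\<close> but not on \<open>F\<close> (\<open>level_set_field\<close>). The flux
    of \<open>T\<close> then recovers the perimeter \<open>P(F)\<close> of \<open>{F > h}\<close> up to the factor \<open>1 - k\<close>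
    (\<open>superlevel_divergence_compare\<close>). Inserting the field \<open>T\<close> of \<open>F\<^sub>1\<close> into the supremum that
    defines \<open>P(F\<^sub>2)\<close> gives \<open>P(F\<^sub>1) \<le> P(F\<^sub>2) + k M + D |{F\<^sub>1 > h} \<triangle> {F\<^sub>2 > h}|\<close>, where \<open>M\<close> bounds all
    perimeters. The symmetric difference lies in the band \<open>\<bar>F\<^sub>1 - h\<bar> \<le> sup \<bar>F\<^sub>1 - F\<^sub>2\<bar>\<close>, and the
    measure of such a band is at most proportional to its width (\<open>level_band_measure\<close>). Choosing
    first \<open>k\<close> and then the distance small, and exchanging \<open>F\<^sub>1\<close> and \<open>F\<^sub>2\<close>, finishes the proof.

  The estimates for the flux and for the band replace the indicator of \<open>{F > h}\<close> by \<open>C\<^sup>1\<close> functions of \<open>F\<close> that climb from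
  \<open>0\<close> to \<open>1\<close> across a thin band of levels and integrate by parts, so the only integral theorem they need is
  that the divergence of a test field integrates to zero.
\<close>

section \<open>Gradients and moduli of continuity\<close>

text \<open>For \<open>\<alpha> = 1\<close> this covers the piecewise quadratic functions below, for general \<open>\<alpha>\<close> the translates of a
  \<open>C\<^sup>1\<^sup>,\<^sup>\<alpha>\<close> kernel.\<close>

lemma has_derivative_from_powr_remainder:
  fixes f :: "'a::real_normed_vector \<Rightarrow> 'b::real_normed_vector"
  assumes "bounded_linear f'" "\<alpha> > 0"
    and rem: "\<And>w. norm w \<le> 1 \<Longrightarrow> norm (f (x + w) - f x - f' w) \<le> C * norm w * norm w powr \<alpha>"
  shows "(f has_derivative f') (at x)"
proof (rule has_derivativeI_sandwich[where e=1 and H="\<lambda>y. C * norm (y - x) powr \<alpha>"])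
  show "norm (f y - f x - f' (y - x)) / norm (y - x) \<le> C * norm (y - x) powr \<alpha>"
    if "y \<noteq> x" "dist y x < 1" for y
    using rem[of "y - x"] that by (simp add: dist_norm divide_simps mult_ac)
  have "((\<lambda>y. norm (y - x)) \<longlongrightarrow> norm (x - x)) (at x)"
    by (intro tendsto_intros)
  then have "((\<lambda>y. norm (y - x)) \<longlongrightarrow> 0) (at x)"
    by simp
  then have "((\<lambda>y. norm (y - x) powr \<alpha>) \<longlongrightarrow> 0 powr \<alpha>) (at x)"
    by (rule tendsto_powr') (use assms(2) in auto)
  from tendsto_mult[OF tendsto_const[of C] this]
  show "((\<lambda>y. C * norm (y - x) powr \<alpha>) \<longlongrightarrow> 0) (at x)"
    by simp
qed (use assms in auto)

lemma continuous_on_GDERIV: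
  assumes "\<And>x. GDERIV F x :> G x"
  shows "continuous_on UNIV F"
  using assms unfolding gderiv_def
  by (meson UNIV_I continuous_at_imp_continuous_on has_derivative_continuous)

lemma continuous_on_if_modulus:
  fixes G :: "'a::real_normed_vector \<Rightarrow> 'b::real_normed_vector"
  assumes "\<And>\<kappa>. 0 < \<kappa> \<Longrightarrow> \<exists>\<rho>>0. \<forall>x y. norm (x - y) \<le> \<rho> \<longrightarrow> norm (G x - G y) \<le> \<kappa>"
  shows "continuous_on UNIV G"
proof (rule continuous_at_imp_continuous_on, rule ballI)
  fix x
  show "isCont G x"
    unfolding continuous_at_eps_delta
  proof (intro allI impI)
    fix e :: real assume "e > 0"
    then obtain \<rho> where \<rho>: "\<rho> > 0" "\<And>x y. norm (x - y) \<le> \<rho> \<Longrightarrow> norm (G x - G y) \<le> e / 2"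
      using assms[of "e / 2"] by (metis half_gt_zero)
    have "dist (G y) (G x) < e" if "dist y x < \<rho>" for y
      using \<rho>(2)[of y x] that \<open>e > 0\<close> by (simp add: dist_norm)
    then show "\<exists>d>0. \<forall>y. dist y x < d \<longrightarrow> dist (G y) (G x) < e"
      using \<rho>(1) by blast
  qed
qed

text \<open>Unfolds the definite description in \<open>gradient\<close> once and for all.\<close>

lemma gradient_eq:
  fixes F :: "'a::euclidean_space \<Rightarrow> real"
  assumes "(F has_derivative f') (at x)"
  shows "GDERIV F x :> gradient F x" and "w \<bullet> gradient F x = f' w"
proof -
  have lin: "linear f'"
    using assms has_derivative_linear by blast
  have f': "f' w = w \<bullet> (\<Sum>b\<in>Basis. f' b *\<^sub>R b)" for w
  proof -
    have "f' w = f' (\<Sum>b\<in>Basis. (w \<bullet> b) *\<^sub>R b)"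
      by (simp add: euclidean_representation)
    also have "\<dots> = w \<bullet> (\<Sum>b\<in>Basis. f' b *\<^sub>R b)"
      by (simp add: linear_sum[OF lin] linear_scale[OF lin] inner_sum_right mult.commute)
    finally show ?thesis .
  qed
  have "f' = (\<lambda>w. w \<bullet> (\<Sum>b\<in>Basis. f' b *\<^sub>R b))"
    by (rule ext) (rule f')
  then have G: "GDERIV F x :> (\<Sum>b\<in>Basis. f' b *\<^sub>R b)"
    using assms unfolding gderiv_def by metis
  have eq: "gradient F x = (\<Sum>b\<in>Basis. f' b *\<^sub>R b)"
    unfolding gradient_def
  proof (rule the_equality, rule G)
    fix D assume "GDERIV F x :> D"
    then have "(\<lambda>w. w \<bullet> D) = f'"
      unfolding gderiv_def using assms has_derivative_unique by blast
    then have "w \<bullet> D = w \<bullet> (\<Sum>b\<in>Basis. f' b *\<^sub>R b)" for w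
      using f' by metis
    then show "D = (\<Sum>b\<in>Basis. f' b *\<^sub>R b)"
      by (metis vector_eq_ldot)
  qed
  show "GDERIV F x :> gradient F x"
    unfolding eq by (rule G)
  show "w \<bullet> gradient F x = f' w"
    unfolding eq by (rule f'[symmetric])
qed

lemma norm_le_if_inner_le:
  fixes v :: "'a::real_inner"
  assumes "0 \<le> B" "\<And>w. \<bar>w \<bullet> v\<bar> \<le> B * norm w"
  shows "norm v \<le> B"
  using assms(1) assms(2)[of v]
  by (cases "v = 0") (auto simp: power2_norm_eq_inner[symmetric] power2_eq_square)

section \<open>Test vector fields and integration by parts\<close>

lemma divergence_eq:
  assumes "(T has_derivative T') (at x)"
  shows "divergence T x = (\<Sum>b\<in>Basis. T' b \<bullet> b)"
  using frechet_derivative_at[OF assms] by (simp add: divergence_def)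

text \<open>In finite dimension a derivative is continuous as soon as its values on the basis vectors are;
  this spares constructing the bounded linear maps that the definition of test fields quantifies over.\<close>

lemma C1_test_fieldsI:
  fixes T :: "'a::euclidean_space \<Rightarrow> 'a"
  assumes der: "\<And>x. (T has_derivative T' x) (at x)"
    and cont: "\<And>b. b \<in> Basis \<Longrightarrow> continuous_on UNIV (\<lambda>x. T' x b)"
    and S: "compact S" "S \<subseteq> B" "\<And>x. x \<notin> S \<Longrightarrow> T x = 0"
  shows "T \<in> C1_test_fields B"
proof -
  have bl: "bounded_linear (T' x)" for x
    using der has_derivative_bounded_linear by blast
  have "\<forall>x. (T has_derivative blinfun_apply (Blinfun (T' x))) (at x)"
    using der by (simp add: bounded_linear_Blinfun_apply[OF bl])
  moreover have "continuous_on UNIV (\<lambda>x. Blinfun (T' x))"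
    by (rule continuous_on_blinfun_componentwise)
      (simp add: bounded_linear_Blinfun_apply[OF bl] cont)
  moreover have "closure {x. T x \<noteq> 0} \<subseteq> S"
    using S by (intro closure_minimal compact_imp_closed) auto
  ultimately show ?thesis
    using S unfolding C1_test_fields_def
    by (auto simp: compact_closure intro: bounded_subset[OF compact_imp_bounded] closure_subset[THEN subsetD])
qed

lemma C1_test_fieldsE:
  fixes T :: "'a::euclidean_space \<Rightarrow> 'a"
  assumes "T \<in> C1_test_fields B"
  obtains T' S M where "\<And>x. (T has_derivative T' x) (at x)"
    "\<And>w. continuous_on UNIV (\<lambda>x. T' x w)" "compact S" "S \<subseteq> B"
    "\<And>x. x \<notin> S \<Longrightarrow> T x = 0" "\<And>x w. x \<notin> S \<Longrightarrow> T' x w = 0"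
    "\<And>x w. norm (T' x w) \<le> M * norm w"
proof -
  define S where "S = closure {x. T x \<noteq> 0}"
  obtain T' :: "'a \<Rightarrow> 'a \<Rightarrow>\<^sub>L 'a" where der: "\<And>x. (T has_derivative blinfun_apply (T' x)) (at x)"
    and cont: "continuous_on UNIV T'" and S: "compact S" "S \<subseteq> B"
    using assms by (auto simp: C1_test_fields_def S_def)
  have T0: "T x = 0" if "x \<notin> S" for x
    using that closure_subset[of "{x. T x \<noteq> 0}"] by (auto simp: S_def)
  have T'0: "T' x = 0" if "x \<notin> S" for x
  proof -
    have "((\<lambda>x. 0) has_derivative blinfun_apply (T' x)) (at x)"
      using has_derivative_transform_within_open[OF der, of "- S" x "\<lambda>x. 0"] that T0 S(1)
      by (auto simp: compact_imp_closed open_Compl)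
    then have "blinfun_apply (T' x) = (\<lambda>_. 0)"
      using has_derivative_unique has_derivative_const by blast
    then show ?thesis
      by (simp add: blinfun_eqI)
  qed
  have "bounded (T' ` S)"
    by (intro compact_imp_bounded compact_continuous_image continuous_on_subset[OF cont] S) simp
  then obtain M where M: "\<And>x. x \<in> S \<Longrightarrow> norm (T' x) \<le> M" and "M > 0"
    by (auto simp: bounded_pos)
  have "norm (T' x) \<le> M" for x
    using M[of x] T'0[of x] \<open>M > 0\<close> by (cases "x \<in> S") auto
  then have "norm (T' x w) \<le> M * norm w" for x w
    by (meson norm_blinfun mult_right_mono norm_ge_zero order_trans)
  moreover have "continuous_on UNIV (\<lambda>x. T' x w)" for w
    by (intro continuous_intros cont)
  ultimately show thesis
    using der S T0 T'0 by (intro that[of T' S M]) auto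
qed

lemma continuous_on_divergence:
  assumes "T \<in> C1_test_fields B"
  shows "continuous_on UNIV (divergence T)"
proof -
  obtain T' where *: "\<And>x. (T has_derivative T' x) (at x)" "\<And>w. continuous_on UNIV (\<lambda>x. T' x w)"
    using C1_test_fieldsE[OF assms] by metis
  show ?thesis
    unfolding divergence_eq[OF *(1), abs_def] by (intro continuous_intros *)
qed

lemma divergence_outside:
  assumes "T \<in> C1_test_fields B" "x \<notin> B"
  shows "T x = 0" "divergence T x = 0"
proof -
  obtain T' S where *: "\<And>x. (T has_derivative T' x) (at x)" "S \<subseteq> B"
    "\<And>x. x \<notin> S \<Longrightarrow> T x = 0" "\<And>x w. x \<notin> S \<Longrightarrow> T' x w = 0"
    using C1_test_fieldsE[OF assms(1)] by metis
  then have "x \<notin> S"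
    using assms(2) by blast
  then show "T x = 0" "divergence T x = 0"
    unfolding divergence_eq[OF *(1)] using *(3,4) by auto
qed

lemma C1_test_fields_continuous:
  assumes "T \<in> C1_test_fields B"
  shows "continuous_on UNIV T"
proof -
  obtain T' where *: "\<And>x. (T has_derivative T' x) (at x)"
    using C1_test_fieldsE[OF assms] by metis
  then show ?thesis
    by (meson UNIV_I continuous_at_imp_continuous_on has_derivative_continuous)
qed

lemma integrable_compactly_supported:
  fixes p :: "'a::euclidean_space \<Rightarrow> real"
  assumes "continuous_on UNIV p" "compact S" "\<And>x. x \<notin> S \<Longrightarrow> p x = 0"
  shows "integrable lborel p"
proof -
  have "integrable lborel (\<lambda>x. indicator S x *\<^sub>R p x)"
    by (rule borel_integrable_compact[OF assms(2) continuous_on_subset[OF assms(1)]]) simp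
  also have "(\<lambda>x. indicator S x *\<^sub>R p x) = p"
    by (rule ext) (use assms(3) in \<open>auto simp: indicator_def\<close>)
  finally show ?thesis .
qed

text \<open>The integral of \<open>(T (x + t b) - T x) / t\<close> vanishes for every \<open>t\<close> by translation invariance, and
  the quotients converge boundedly, inside a fixed ball, to the directional derivative.\<close>

lemma integral_directional_derivative_eq_0:
  fixes T :: "'a::euclidean_space \<Rightarrow> 'a"
  assumes "T \<in> C1_test_fields B"
    and der: "\<And>x. (T has_derivative T' x) (at x)"
    and b: "b \<in> Basis"
  shows "(LINT x|lborel. T' x b \<bullet> b) = 0" "integrable lborel (\<lambda>x. T' x b \<bullet> b)"
proof -
  obtain T'' S M where *: "\<And>x. (T has_derivative T'' x) (at x)"
    "\<And>w. continuous_on UNIV (\<lambda>x. T'' x w)" "compact S" "S \<subseteq> B"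
    "\<And>x. x \<notin> S \<Longrightarrow> T x = 0" "\<And>x w. x \<notin> S \<Longrightarrow> T'' x w = 0"
    "\<And>x w. norm (T'' x w) \<le> M * norm w"
    by (rule C1_test_fieldsE[OF assms(1)]; rule that; assumption)
  have "T'' = T'"
    using has_derivative_unique *(1) der by blast
  note * = *[unfolded this]
  have M0: "0 \<le> M"
    using order_trans[OF norm_ge_zero *(7)[of 0 b]] b by simp
  have cT: "continuous_on UNIV T"
    using C1_test_fields_continuous assms(1) by blast
  obtain r where r: "r > 0" "\<And>x. x \<in> S \<Longrightarrow> norm x \<le> r"
    using compact_imp_bounded[OF *(3)] by (auto simp: bounded_pos)
  show "integrable lborel (\<lambda>x. T' x b \<bullet> b)"
    by (rule integrable_compactly_supported[OF _ *(3)]) (auto intro!: continuous_intros * simp: *)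
  define q where "q n x = ((T (inverse (real (Suc n)) *\<^sub>R b + x) - T x) \<bullet> b) * real (Suc n)" for n :: nat and x
  have int: "integrable lborel (\<lambda>x. T x \<bullet> b)"
    by (rule integrable_compactly_supported[OF _ *(3)]) (auto intro!: continuous_intros cT simp: *)
  have distr: "integrable lborel (\<lambda>x. T (c + x) \<bullet> b)" "(LINT x|lborel. T (c + x) \<bullet> b) = (LINT x|lborel. T x \<bullet> b)" for c
  proof -
    have m: "(\<lambda>x. T x \<bullet> b) \<in> borel_measurable borel"
      using int by auto
    have m': "(+) c \<in> lborel \<rightarrow>\<^sub>M borel"
      by simp
    show "integrable lborel (\<lambda>x. T (c + x) \<bullet> b)"
      using int integrable_distr_eq[OF m' m] by (simp add: lborel_distr_plus)
    show "(LINT x|lborel. T (c + x) \<bullet> b) = (LINT x|lborel. T x \<bullet> b)"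
      using integral_distr[OF m' m] by (simp add: lborel_distr_plus)
  qed
  have q0: "(LINT x|lborel. q n x) = 0" for n
    unfolding q_def using distr int by (simp add: inner_diff_left)
  have "(\<lambda>n. LINT x|lborel. q n x) \<longlonglongrightarrow> (LINT x|lborel. T' x b \<bullet> b)"
  proof (rule integral_dominated_convergence[where w="\<lambda>x. M * indicator (cball 0 (r+1)) x"])
    show "(\<lambda>x. T' x b \<bullet> b) \<in> borel_measurable lborel"
      by (simp, intro borel_measurable_continuous_onI continuous_intros *)
    show "q n \<in> borel_measurable lborel" for n
      unfolding q_def
      by (simp, intro borel_measurable_continuous_onI continuous_intros continuous_on_compose2[OF cT]) auto
    show "integrable lborel (\<lambda>x. M * indicator (cball 0 (r+1)) x :: real)"
      using emeasure_bounded_finite[OF bounded_cball, of 0 "r+1"]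
      by (intro integrable_mult_right integrable_real_indicator) auto
    show "AE x in lborel. (\<lambda>n. q n x) \<longlonglongrightarrow> T' x b \<bullet> b"
    proof (rule AE_I2)
      fix x
      have "((\<lambda>t. T (x + t *\<^sub>R b) \<bullet> b) has_derivative (\<lambda>t. t * (T' x b \<bullet> b))) (at 0)"
      proof -
        have "(T has_derivative T' x) (at (x + 0 *\<^sub>R b))"
          using der by simp
        moreover have "((\<lambda>t. x + t *\<^sub>R b) has_derivative (\<lambda>t. t *\<^sub>R b)) (at 0)"
          by (auto intro!: derivative_eq_intros)
        ultimately have "((\<lambda>t. T (x + t *\<^sub>R b)) has_derivative (\<lambda>t. T' x (t *\<^sub>R b))) (at 0)"
          using has_derivative_compose[where f="\<lambda>t. x + t *\<^sub>R b" and f'="\<lambda>t. t *\<^sub>R b" and x="0::real" and s=UNIV and g=T and g'="T' x"]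
          by blast
        then have "((\<lambda>t. T (x + t *\<^sub>R b) \<bullet> b) has_derivative (\<lambda>t. T' x (t *\<^sub>R b) \<bullet> b)) (at 0)"
          by (auto intro!: derivative_eq_intros)
        then show ?thesis
          using linear_scale[OF has_derivative_linear[OF der[of x]]] by simp
      qed
      then have "((\<lambda>t. T (x + t *\<^sub>R b) \<bullet> b) has_real_derivative (T' x b \<bullet> b)) (at 0)"
        by (simp add: has_field_derivative_def mult.commute[of _ "T' x b \<bullet> b"])
      then have lim: "(\<lambda>t. (T (x + t *\<^sub>R b) \<bullet> b - T x \<bullet> b) / t) \<midarrow>0\<rightarrow> T' x b \<bullet> b"
        by (simp add: DERIV_def)
      have inv: "filterlim (\<lambda>n. inverse (real (Suc n))) (at 0) sequentially"
        using LIMSEQ_inverse_real_of_nat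
        by (auto simp: filterlim_at)
      show "(\<lambda>n. q n x) \<longlonglongrightarrow> T' x b \<bullet> b"
        using filterlim_compose[OF lim inv]
        by (simp add: q_def inner_diff_left add.commute divide_simps)
    qed
    show "AE x in lborel. norm (q n x) \<le> M * indicator (cball 0 (r+1)) x" for n
    proof (rule AE_I2)
      fix x
      define e where "e = inverse (real (Suc n))"
      have e: "0 < e" "e \<le> 1"
        by (auto simp: e_def divide_simps)
      show "norm (q n x) \<le> M * indicator (cball 0 (r+1)) x"
      proof (cases "norm x \<le> r + 1")
        case True
        have "norm (T (e *\<^sub>R b + x) - T x) \<le> M * norm ((e *\<^sub>R b + x) - x)"
        proof (rule differentiable_bound[where S=UNIV and f'=T'])
          show "onorm (T' y) \<le> M" for y
            using *(7) by (intro onorm_le) auto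
        qed (use der in auto)
        then have "\<bar>(T (e *\<^sub>R b + x) - T x) \<bullet> b\<bar> \<le> M * e"
          using Basis_le_norm[OF b, of "T (e *\<^sub>R b + x) - T x"] b e by simp
        then have "\<bar>(T (e *\<^sub>R b + x) - T x) \<bullet> b\<bar> * real (Suc n) \<le> M * e * real (Suc n)"
          by (rule mult_right_mono) simp
        also have "\<dots> = M"
          by (simp add: e_def)
        finally show ?thesis
          using True by (simp add: q_def abs_mult e_def)
      next
        case False
        have "norm (e *\<^sub>R b) \<le> 1"
          using b e by simp
        then have "norm (e *\<^sub>R b + x) > r"
          using False norm_triangle_ineq2[of x "- (e *\<^sub>R b)"] by (simp add: add.commute)
        then have "T (e *\<^sub>R b + x) = 0" "T x = 0"
          using r *(5) False by (meson linorder_not_le order_trans less_add_one less_le)+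
        then show ?thesis
          using False by (simp add: q_def e_def)
      qed
    qed
  qed
  then show "(LINT x|lborel. T' x b \<bullet> b) = 0"
    by (simp add: q0 LIMSEQ_const_iff)
qed

lemma integral_divergence_eq_0:
  fixes T :: "'a::euclidean_space \<Rightarrow> 'a"
  assumes "T \<in> C1_test_fields B"
  shows "(LINT x|lborel. divergence T x) = 0"
proof -
  obtain T' where *: "\<And>x. (T has_derivative T' x) (at x)"
    using C1_test_fieldsE[OF assms] by metis
  show ?thesis
    unfolding divergence_eq[OF *]
    by (subst Bochner_Integration.integral_sum) (auto simp: integral_directional_derivative_eq_0[OF assms *])
qed

text \<open>The product \<open>P T\<close> is again a test field, so its divergence integrates to zero.\<close>

lemma integral_divergence_by_parts:
  fixes T :: "'a::euclidean_space \<Rightarrow> 'a"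
  assumes T: "T \<in> C1_test_fields B"
    and P: "\<And>x. GDERIV P x :> Q x" "continuous_on UNIV Q"
  shows "(LINT x|lborel. P x * divergence T x) = - (LINT x|lborel. Q x \<bullet> T x)"
    and "integrable lborel (\<lambda>x. P x * divergence T x)" "integrable lborel (\<lambda>x. Q x \<bullet> T x)"
proof -
  obtain T' S M where *: "\<And>x. (T has_derivative T' x) (at x)"
    "\<And>w. continuous_on UNIV (\<lambda>x. T' x w)" "compact S" "S \<subseteq> B"
    "\<And>x. x \<notin> S \<Longrightarrow> T x = 0" "\<And>x w. x \<notin> S \<Longrightarrow> T' x w = 0"
    "\<And>x w. norm (T' x w) \<le> M * norm w"
    by (rule C1_test_fieldsE[OF assms(1)]; rule that; assumption)
  have cT: "continuous_on UNIV T"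
    using C1_test_fields_continuous T by blast
  have cP: "continuous_on UNIV P"
    using P(1) unfolding gderiv_def
    by (meson UNIV_I continuous_at_imp_continuous_on has_derivative_continuous)
  have der: "((\<lambda>x. P x *\<^sub>R T x) has_derivative (\<lambda>w. P x *\<^sub>R T' x w + (w \<bullet> Q x) *\<^sub>R T x)) (at x)" for x
    using P(1)[of x] *(1)[of x] unfolding gderiv_def by (auto intro!: derivative_eq_intros)
  have PT: "(\<lambda>x. P x *\<^sub>R T x) \<in> C1_test_fields B"
    by (rule C1_test_fieldsI[OF der _ *(3,4)]) (auto intro!: continuous_intros cP P * cT simp: *)
  have eq: "divergence (\<lambda>x. P x *\<^sub>R T x) x = P x * divergence T x + Q x \<bullet> T x" for x
    unfolding divergence_eq[OF der] divergence_eq[OF *(1)]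
    by (simp add: inner_add_left inner_add_right sum.distrib sum_distrib_left euclidean_inner[of "Q x" "T x"] inner_commute)
  show i: "integrable lborel (\<lambda>x. P x * divergence T x)"
    by (rule integrable_compactly_supported[OF _ *(3)])
      (auto intro!: continuous_intros cP continuous_on_divergence[OF T] simp: divergence_eq[OF *(1)] *)
  show i': "integrable lborel (\<lambda>x. Q x \<bullet> T x)"
    by (rule integrable_compactly_supported[OF _ *(3)])
      (auto intro!: continuous_intros P cT simp: *)
  show "(LINT x|lborel. P x * divergence T x) = - (LINT x|lborel. Q x \<bullet> T x)"
    using integral_divergence_eq_0[OF PT] i i' by (simp add: eq)
qed

section \<open>Smooth ramps\<close>

text \<open>A piecewise quadratic \<open>C\<^sup>1\<close> step from \<open>0\<close> (on \<open>s \<le> 0\<close>) to \<open>1\<close> (on \<open>s \<ge> 2\<close>), written with second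
  differences of squared positive parts so that its derivative needs no case distinction.\<close>

definition ramp :: "real \<Rightarrow> real" where
  "ramp s = ((max 0 s)\<^sup>2 - 2 * (max 0 (s - 1))\<^sup>2 + (max 0 (s - 2))\<^sup>2) / 2"

text \<open>The derivative of \<open>ramp\<close>: the tent function on \<open>[0, 2]\<close> with peak \<open>1\<close>.\<close>

definition hat :: "real \<Rightarrow> real" where
  "hat s = max 0 s - 2 * max 0 (s - 1) + max 0 (s - 2)"

lemma DERIV_max_0_squared: "((\<lambda>s. (max 0 (s - a))\<^sup>2) has_real_derivative 2 * max 0 (s - a)) (at (s::real))"
proof -
  have rem: "\<bar>(max 0 (s + w - a))\<^sup>2 - (max 0 (s - a))\<^sup>2 - 2 * max 0 (s - a) * w\<bar> \<le> w\<^sup>2" for w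
  proof -
    define x where "x = s - a"
    have *: "s + w - a = x + w"
      by (simp add: x_def)
    have "\<bar>(max 0 (x + w))\<^sup>2 - (max 0 x)\<^sup>2 - 2 * max 0 x * w\<bar> \<le> w\<^sup>2"
    proof (cases "x \<ge> 0"; cases "x + w \<ge> 0")
      assume "x \<ge> 0" "x + w \<ge> 0"
      then have "max 0 (x + w) = x + w" "max 0 x = x"
        by auto
      then show ?thesis
        by (simp add: power2_sum algebra_simps)
    next
      assume a: "x \<ge> 0" "\<not> x + w \<ge> 0"
      then have "max 0 (x + w) = 0" "max 0 x = x"
        by auto
      moreover have "0 \<le> x * (- 2 * w - x)" "0 \<le> (x + w)\<^sup>2"
        using a by (auto intro!: mult_nonneg_nonneg)
      ultimately show ?thesis
        by (simp add: power2_eq_square algebra_simps)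
    next
      assume a: "\<not> x \<ge> 0" "x + w \<ge> 0"
      then have "max 0 (x + w) = x + w" "max 0 x = 0"
        by auto
      moreover have "(x + w)\<^sup>2 \<le> w\<^sup>2"
        using a by (intro power_mono) auto
      ultimately show ?thesis
        by simp
    qed auto
    then show ?thesis
      by (simp only: * x_def[symmetric])
  qed
  have "((\<lambda>s. (max 0 (s - a))\<^sup>2) has_derivative (\<lambda>w. 2 * max 0 (s - a) * w)) (at s)"
  proof (rule has_derivative_from_powr_remainder[where \<alpha>=1 and C=1])
    show "norm ((max 0 (s + w - a))\<^sup>2 - (max 0 (s - a))\<^sup>2 - 2 * max 0 (s - a) * w) \<le> 1 * norm w * norm w powr 1" for w
      using rem[of w] by (cases "w = 0") (auto simp: power2_eq_square)
  qed (auto intro: bounded_linear_mult_right)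
  then show ?thesis
    by (simp add: has_field_derivative_def)
qed

lemma DERIV_ramp: "(ramp has_real_derivative hat s) (at s)"
proof -
  note d = DERIV_max_0_squared[of 0 s, simplified] DERIV_max_0_squared[of 1 s] DERIV_max_0_squared[of 2 s]
  have "((\<lambda>s. ((max 0 s)\<^sup>2 - 2 * (max 0 (s - 1))\<^sup>2 + (max 0 (s - 2))\<^sup>2) / 2) has_real_derivative hat s) (at s)"
    by (rule DERIV_cong[OF DERIV_cdivide[OF DERIV_add[OF DERIV_diff[OF d(1) DERIV_cmult[OF d(2)]] d(3)]]])
      (simp add: hat_def)
  then show ?thesis
    by (simp add: ramp_def[abs_def])
qed

lemma continuous_on_hat [continuous_intros]: "continuous_on A p \<Longrightarrow> continuous_on A (\<lambda>x. hat (p x))"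
  unfolding hat_def by (intro continuous_intros)

lemma continuous_on_ramp [continuous_intros]: "continuous_on A p \<Longrightarrow> continuous_on A (\<lambda>x. ramp (p x))"
  unfolding ramp_def by (intro continuous_intros) auto

lemma hat_bounds: "0 \<le> hat s" "hat s \<le> 1" "s \<le> 0 \<Longrightarrow> hat s = 0" "2 \<le> s \<Longrightarrow> hat s = 0"
  "1/2 \<le> s \<Longrightarrow> s \<le> 3/2 \<Longrightarrow> 1/2 \<le> hat s"
  by (auto simp: hat_def max_def)

lemma ramp_eq: "s \<le> 0 \<Longrightarrow> ramp s = 0" "2 \<le> s \<Longrightarrow> ramp s = 1"
  by (auto simp: ramp_def max_def power2_eq_square algebra_simps)

lemma ramp_bounds: "0 \<le> ramp s" "ramp s \<le> 1"
proof -
  have "mono ramp"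
    by (rule monoI, rule DERIV_nonneg_imp_nondecreasing) (use DERIV_ramp hat_bounds(1) in blast)+
  then have "ramp (min s 0) \<le> ramp s" "ramp s \<le> ramp (max s 2)"
    by (auto intro: monoD)
  then show "0 \<le> ramp s" "ramp s \<le> 1"
    by (auto simp: ramp_eq)
qed

lemma GDERIV_ramp:
  assumes "GDERIV F x :> d"
  shows "GDERIV (\<lambda>x. ramp (m * (F x - s) + r)) x :> (m * hat (m * (F x - s) + r)) *\<^sub>R d"
proof -
  have "((\<lambda>y. ramp (m * (y - s) + r)) has_real_derivative m * hat (m * (F x - s) + r)) (at (F x))"
    by (rule DERIV_chain'[OF _ DERIV_ramp, THEN DERIV_cong]) (auto intro!: derivative_eq_intros)
  then show ?thesis
    using GDERIV_DERIV_compose[OF assms] by auto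
qed


section \<open>A test field almost normal to the level sets\<close>

lemma difference_quotient_near_gradient:
  fixes F :: "'a::euclidean_space \<Rightarrow> real"
  assumes grad: "\<And>x. GDERIV F x :> G x"
    and mod: "\<And>x y. norm (x - y) \<le> \<rho> \<Longrightarrow> norm (G x - G y) \<le> \<kappa>"
    and "0 < \<rho>" "b \<in> Basis"
  shows "\<bar>(F (x + \<rho> *\<^sub>R b) - F x) / \<rho> - G x \<bullet> b\<bar> \<le> \<kappa>"
proof -
  have "((\<lambda>t. F (x + t *\<^sub>R b)) has_real_derivative G (x + t *\<^sub>R b) \<bullet> b) (at t)" for t
  proof -
    have "((\<lambda>t. F (x + t *\<^sub>R b)) has_derivative (\<lambda>h. (h *\<^sub>R b) \<bullet> G (x + t *\<^sub>R b))) (at t)"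
      by (rule has_derivative_compose[where g=F, OF _ grad[unfolded gderiv_def]])
        (auto intro!: derivative_eq_intros)
    then show ?thesis
      by (simp add: has_field_derivative_def inner_commute[of b] mult.commute[of _ "G (x + t *\<^sub>R b) \<bullet> b"])
  qed
  then obtain t where t: "0 < t" "t < \<rho>"
    "F (x + \<rho> *\<^sub>R b) - F (x + 0 *\<^sub>R b) = (\<rho> - 0) * (G (x + t *\<^sub>R b) \<bullet> b)"
    using MVT2[OF \<open>0 < \<rho>\<close>, of "\<lambda>t. F (x + t *\<^sub>R b)" "\<lambda>t. G (x + t *\<^sub>R b) \<bullet> b"] by blast
  then have "(F (x + \<rho> *\<^sub>R b) - F x) / \<rho> - G x \<bullet> b = (G (x + t *\<^sub>R b) - G x) \<bullet> b"
    using \<open>0 < \<rho>\<close> by (simp add: inner_diff_left)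
  also have "\<bar>\<dots>\<bar> \<le> norm (G (x + t *\<^sub>R b) - G x)"
    using Basis_le_norm assms(4) by blast
  also have "\<dots> \<le> \<kappa>"
    using t assms(4) by (intro mod) auto
  finally show ?thesis .
qed

text \<open>The unit normal \<open>- \<nabla>F / \<parallel>\<nabla>F\<parallel>\<close> of the level sets is the ideal test field, but it is only as
  regular as \<open>G = \<nabla>F\<close>. Replacing the partial derivatives by difference quotients \<open>V\<close> of step \<open>\<rho>\<close>
  makes it \<open>C\<^sup>1\<close>: the modulus of continuity of \<open>G\<close> gives \<open>\<parallel>V - G\<parallel> \<le> n \<kappa>\<close>, where \<open>n\<close> is the dimension,
  and the derivative of \<open>V\<close> is again a difference quotient, bounded by \<open>n \<kappa> / \<rho>\<close>. Dividing by
  \<open>\<surd>(\<parallel>V\<parallel>\<^sup>2 + \<kappa>\<^sup>2)\<close> instead of \<open>\<parallel>V\<parallel>\<close> avoids the zeros of \<open>V\<close> and costs a factor \<open>1 / \<kappa>\<close> in the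
  derivative, which cancels the \<open>\<kappa>\<close> above. A cutoff depending on \<open>F\<close> alone, equal to \<open>1\<close> for
  \<open>F \<ge> h - \<delta>/2\<close> and to \<open>0\<close> for \<open>F \<le> h - \<delta>\<close>, makes the support compact.\<close>

lemma level_set_field:
  fixes F :: "'a::euclidean_space \<Rightarrow> real" and L \<rho> \<kappa> \<delta> c h :: real
  assumes grad: "\<And>x. GDERIV F x :> G x" and contG: "continuous_on UNIV G"
    and L: "\<And>x. norm (G x) \<le> L"
    and mod: "\<And>x y. norm (x - y) \<le> \<rho> \<Longrightarrow> norm (G x - G y) \<le> \<kappa>"
    and pos: "0 < \<rho>" "0 < \<kappa>" "0 < \<delta>" and small: "3 * DIM('a) * \<kappa> \<le> c"
    and nondeg: "\<And>x. \<bar>F x - h\<bar> \<le> \<delta> \<Longrightarrow> c \<le> norm (G x)"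
    and sub: "{x. F x \<ge> h - \<delta>} \<subseteq> B" and B: "bounded B"
  obtains T where "T \<in> C1_test_fields B" "\<And>x. norm (T x) \<le> 1"
    "\<And>x. \<bar>divergence T x\<bar> \<le> DIM('a) * (2 * DIM('a) / \<rho> + 4 * L / \<delta>)"
    "\<And>x. \<bar>F x - h\<bar> \<le> \<delta> / 2 \<Longrightarrow> (1 - 3 * DIM('a) * \<kappa> / c) * norm (G x) \<le> - (G x \<bullet> T x)"
proof -
  define n where "n = real DIM('a)"
  have n: "n \<ge> 1"
    unfolding n_def using DIM_positive[where 'a='a] by linarith
  define V where "V x = (\<Sum>b\<in>Basis. ((F (x + \<rho> *\<^sub>R b) - F x) / \<rho>) *\<^sub>R b)" for x
  define V' where "V' x w = (\<Sum>b\<in>Basis. ((w \<bullet> (G (x + \<rho> *\<^sub>R b) - G x)) / \<rho>) *\<^sub>R b)" for x w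
  define \<sigma> where "\<sigma> x = sqrt (V x \<bullet> V x + \<kappa>\<^sup>2)" for x
  define \<eta> where "\<eta> x = ramp (4 / \<delta> * (F x - (h - \<delta>)) + 0)" for x
  define \<eta>' where "\<eta>' x = (4 / \<delta> * hat (4 / \<delta> * (F x - (h - \<delta>)) + 0)) *\<^sub>R G x" for x
  define T where "T x = - ((\<eta> x / \<sigma> x) *\<^sub>R V x)" for x
  define k' where "k' x w = (w \<bullet> \<eta>' x) / \<sigma> x - \<eta> x * (V x \<bullet> V' x w) / \<sigma> x ^ 3" for x w
  define T' where "T' x w = - ((\<eta> x / \<sigma> x) *\<^sub>R V' x w + k' x w *\<^sub>R V x)" for x w
  have Fder: "(F has_derivative (\<lambda>w. w \<bullet> G x)) (at x)" for x
    using grad by (simp add: gderiv_def)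
  have cF: "continuous_on UNIV F"
    by (meson Fder UNIV_I continuous_at_imp_continuous_on has_derivative_continuous)
  have Fsh: "((\<lambda>x. F (x + v)) has_derivative (\<lambda>w. w \<bullet> G (x + v))) (at x)" for x v
    by (rule has_derivative_compose[where g=F, OF _ Fder]) (auto intro!: derivative_eq_intros)
  have Vder: "(V has_derivative V' x) (at x)" for x
    unfolding V_def V'_def
  proof (rule has_derivative_sum)
    fix b :: 'a
    have "((\<lambda>x. F (x + \<rho> *\<^sub>R b) - F x) has_derivative (\<lambda>w. w \<bullet> (G (x + \<rho> *\<^sub>R b) - G x))) (at x)"
      by (rule has_derivative_eq_rhs[OF has_derivative_diff[OF Fsh Fder]]) (simp add: inner_diff_right)
    moreover have "bounded_linear (\<lambda>r. (r / \<rho>) *\<^sub>R b)"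
      by (intro bounded_linear_scaleR_const bounded_linear_divide)
    ultimately show "((\<lambda>x. ((F (x + \<rho> *\<^sub>R b) - F x) / \<rho>) *\<^sub>R b) has_derivative
        (\<lambda>w. ((w \<bullet> (G (x + \<rho> *\<^sub>R b) - G x)) / \<rho>) *\<^sub>R b)) (at x)"
      by (rule bounded_linear.has_derivative[rotated])
  qed
  have \<eta>der: "(\<eta> has_derivative (\<lambda>w. w \<bullet> \<eta>' x)) (at x)" for x
    using GDERIV_ramp[OF grad] unfolding \<eta>_def \<eta>'_def gderiv_def .
  have arg: "V x \<bullet> V x + \<kappa>\<^sup>2 > 0" for x
    using pos by (simp add: add_nonneg_pos)
  have \<sigma>pos: "\<sigma> x > 0" for x
    using arg by (simp add: \<sigma>_def)
  have \<sigma>\<kappa>: "\<kappa> \<le> \<sigma> x" and \<sigma>V: "norm (V x) \<le> \<sigma> x" and \<sigma>le: "\<sigma> x \<le> norm (V x) + \<kappa>" for x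
    using pos unfolding \<sigma>_def
    by (auto intro!: real_le_rsqrt real_le_lsqrt simp: power2_norm_eq_inner power2_sum)
  have \<sigma>der: "(\<sigma> has_derivative (\<lambda>w. (V x \<bullet> V' x w) / \<sigma> x)) (at x)" for x
  proof -
    have "((\<lambda>x. V x \<bullet> V x + \<kappa>\<^sup>2) has_derivative (\<lambda>w. 2 * (V x \<bullet> V' x w))) (at x)"
      using Vder[of x] by (auto intro!: derivative_eq_intros simp: inner_commute)
    from has_derivative_real_sqrt[OF arg this] show ?thesis
      unfolding \<sigma>_def by (simp add: field_simps)
  qed
  have kder: "((\<lambda>x. \<eta> x / \<sigma> x) has_derivative k' x) (at x)" for x
    using \<sigma>pos[of x]
    by (auto intro!: derivative_eq_intros \<eta>der \<sigma>der simp: k'_def field_simps power3_eq_cube)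
  have Tder: "(T has_derivative T' x) (at x)" for x
    unfolding T_def T'_def by (rule has_derivative_minus[OF has_derivative_scaleR[OF kder Vder]])
  have cV: "continuous_on UNIV V"
    by (meson Vder UNIV_I continuous_at_imp_continuous_on has_derivative_continuous)
  have cV': "continuous_on UNIV (\<lambda>x. V' x w)" for w
    unfolding V'_def using pos
    by (intro continuous_intros contG continuous_on_compose2[OF contG]) auto
  have c\<sigma>: "continuous_on UNIV \<sigma>"
    unfolding \<sigma>_def by (intro continuous_intros cV)
  have c\<eta>: "continuous_on UNIV \<eta>"
    unfolding \<eta>_def by (intro continuous_intros cF)
  have c\<eta>': "continuous_on UNIV \<eta>'"
    unfolding \<eta>'_def by (intro continuous_intros cF contG)
  have cT': "continuous_on UNIV (\<lambda>x. T' x w)" for w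
    unfolding T'_def k'_def using \<sigma>pos
    by (intro continuous_intros cV cV' c\<sigma> c\<eta> c\<eta>') (auto simp: less_imp_neq[THEN not_sym])
  have \<eta>01: "0 \<le> \<eta> x" "\<eta> x \<le> 1" for x
    by (auto simp: \<eta>_def ramp_bounds)
  have normT: "norm (T x) \<le> 1" for x
  proof -
    have "norm (T x) = \<eta> x * (norm (V x) / \<sigma> x)"
      using \<eta>01 \<sigma>pos[of x] by (simp add: T_def)
    also have "\<dots> \<le> 1 * 1"
      using \<eta>01 \<sigma>pos[of x] \<sigma>V[of x] by (intro mult_mono) auto
    finally show ?thesis by simp
  qed
  have T0: "T x = 0" if "F x < h - \<delta>" for x
  proof -
    have "4 / \<delta> * (F x - (h - \<delta>)) + 0 \<le> 0"
      using mult_nonneg_nonpos[of "4 / \<delta>" "F x - (h - \<delta>)"] that pos by simp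
    then show ?thesis
      by (simp add: T_def \<eta>_def ramp_eq)
  qed
  have V'n: "norm (V' x w) \<le> n * \<kappa> / \<rho> * norm w" for x w
  proof -
    have "norm (V' x w) \<le> (\<Sum>b\<in>(Basis::'a set). \<kappa> / \<rho> * norm w)"
      unfolding V'_def
    proof (rule sum_norm_le)
      fix b :: 'a assume b: "b \<in> Basis"
      have "\<bar>w \<bullet> (G (x + \<rho> *\<^sub>R b) - G x)\<bar> \<le> norm w * norm (G (x + \<rho> *\<^sub>R b) - G x)"
        by (rule Cauchy_Schwarz_ineq2)
      also have "\<dots> \<le> norm w * \<kappa>"
        using b pos by (intro mult_left_mono mod) auto
      finally show "norm ((w \<bullet> (G (x + \<rho> *\<^sub>R b) - G x) / \<rho>) *\<^sub>R b) \<le> \<kappa> / \<rho> * norm w"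
        using b pos by (simp add: divide_simps mult_ac)
    qed
    then show ?thesis by (simp add: n_def)
  qed
  have \<eta>'n: "norm (\<eta>' x) \<le> 4 * L / \<delta>" for x
  proof -
    have "norm (\<eta>' x) = (4 / \<delta>) * (hat (4 / \<delta> * (F x - (h - \<delta>)) + 0) * norm (G x))"
      using pos hat_bounds(1)[of "4 / \<delta> * (F x - (h - \<delta>)) + 0"] by (simp add: \<eta>'_def)
    also have "\<dots> \<le> (4 / \<delta>) * (1 * L)"
      using pos L by (intro mult_left_mono mult_mono hat_bounds) auto
    finally show ?thesis by simp
  qed
  have T'n: "norm (T' x w) \<le> (2 * n / \<rho> + 4 * L / \<delta>) * norm w" for x w
  proof -
    have "norm ((\<eta> x / \<sigma> x) *\<^sub>R V' x w) = \<eta> x * (norm (V' x w) / \<sigma> x)"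
      using \<eta>01 \<sigma>pos[of x] by simp
    also have "\<dots> \<le> 1 * (norm (V' x w) / \<kappa>)"
      using \<eta>01 \<sigma>pos[of x] \<sigma>\<kappa>[of x] pos by (intro mult_mono divide_left_mono) auto
    finally have 1: "norm ((\<eta> x / \<sigma> x) *\<^sub>R V' x w) \<le> norm (V' x w) / \<kappa>" by simp
    have "\<bar>k' x w\<bar> * norm (V x) \<le> \<bar>k' x w\<bar> * \<sigma> x"
      using \<sigma>V by (intro mult_left_mono) auto
    also have "\<dots> = \<bar>w \<bullet> \<eta>' x - \<eta> x * ((V x \<bullet> V' x w) / \<sigma> x ^ 2)\<bar>"
      using \<sigma>pos[of x] by (subst abs_of_pos[of "\<sigma> x", symmetric], simp)
        (simp add: abs_mult[symmetric] k'_def field_simps power3_eq_cube power2_eq_square)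
    also have "\<dots> \<le> \<bar>w \<bullet> \<eta>' x\<bar> + \<bar>\<eta> x * ((V x \<bullet> V' x w) / \<sigma> x ^ 2)\<bar>"
      by (rule abs_triangle_ineq4)
    also have "\<bar>w \<bullet> \<eta>' x\<bar> \<le> norm w * norm (\<eta>' x)"
      by (rule Cauchy_Schwarz_ineq2)
    also have "\<dots> \<le> norm w * (4 * L / \<delta>)"
      by (intro mult_left_mono \<eta>'n) auto
    also have "\<bar>\<eta> x * ((V x \<bullet> V' x w) / \<sigma> x ^ 2)\<bar> = \<eta> x * (\<bar>V x \<bullet> V' x w\<bar> / \<sigma> x ^ 2)"
      using \<eta>01 by (simp add: abs_mult)
    also have "\<dots> \<le> 1 * ((\<sigma> x * norm (V' x w)) / \<sigma> x ^ 2)"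
      using \<eta>01 \<sigma>V \<sigma>pos[of x]
      by (intro mult_mono divide_right_mono order_trans[OF Cauchy_Schwarz_ineq2] mult_right_mono) auto
    also have "\<dots> = norm (V' x w) / \<sigma> x"
      using \<sigma>pos[of x] by (simp add: power2_eq_square)
    also have "\<dots> \<le> norm (V' x w) / \<kappa>"
      using \<sigma>pos[of x] \<sigma>\<kappa>[of x] pos by (intro divide_left_mono) auto
    finally have 2: "\<bar>k' x w\<bar> * norm (V x) \<le> norm w * (4 * L / \<delta>) + norm (V' x w) / \<kappa>"
      by simp
    have "norm (T' x w) \<le> norm ((\<eta> x / \<sigma> x) *\<^sub>R V' x w) + norm (k' x w *\<^sub>R V x)"
      unfolding T'_def norm_minus_cancel by (rule norm_triangle_ineq)
    also have "\<dots> \<le> norm (V' x w) / \<kappa> + (norm w * (4 * L / \<delta>) + norm (V' x w) / \<kappa>)"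
      using 1 2 by (intro add_mono) auto
    also have "norm (V' x w) / \<kappa> \<le> (n * \<kappa> / \<rho> * norm w) / \<kappa>"
      using V'n pos by (intro divide_right_mono) auto
    also have "\<dots> = n / \<rho> * norm w"
      using pos by simp
    finally show ?thesis
      by (simp add: algebra_simps)
  qed
  have "T \<in> C1_test_fields B"
  proof (rule C1_test_fieldsI[OF Tder cT'])
    have "closed {x. F x \<ge> h - \<delta>}"
      using cF by (intro closed_Collect_le) auto
    then show "compact {x. F x \<ge> h - \<delta>}"
      using bounded_subset[OF B sub] by (simp add: compact_eq_bounded_closed)
  qed (use sub T0 in \<open>auto simp: not_le\<close>)
  moreover have "\<bar>divergence T x\<bar> \<le> n * (2 * n / \<rho> + 4 * L / \<delta>)" for x
  proof -
    have "\<bar>divergence T x\<bar> \<le> (\<Sum>b\<in>(Basis::'a set). 2 * n / \<rho> + 4 * L / \<delta>)"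
      unfolding divergence_eq[OF Tder] real_norm_def[symmetric]
    proof (rule sum_norm_le)
      fix b :: 'a assume b: "b \<in> Basis"
      show "norm (T' x b \<bullet> b) \<le> 2 * n / \<rho> + 4 * L / \<delta>"
        using order_trans[OF Basis_le_norm[OF b] T'n[of x b]] b by simp
    qed
    then show ?thesis by (simp add: n_def)
  qed
  moreover have "(1 - 3 * n * \<kappa> / c) * norm (G x) \<le> - (G x \<bullet> T x)" if "\<bar>F x - h\<bar> \<le> \<delta> / 2" for x
  proof -
    define \<gamma> where "\<gamma> = norm (G x)"
    have c: "3 * n * \<kappa> \<le> c" "0 < c"
      using small n pos by (auto simp: n_def intro: less_le_trans[of 0 "3 * n * \<kappa>"])
    have \<gamma>: "c \<le> \<gamma>"
      unfolding \<gamma>_def using that pos by (intro nondeg) auto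
    have "\<delta> / 2 \<le> F x - (h - \<delta>)"
      using that unfolding abs_le_iff by linarith
    then have "4 / \<delta> * (F x - (h - \<delta>)) \<ge> 4 / \<delta> * (\<delta> / 2)"
      using pos by (intro mult_left_mono) auto
    then have \<eta>1: "\<eta> x = 1"
      using pos by (simp add: \<eta>_def ramp_eq)
    have GV: "norm (V x - G x) \<le> n * \<kappa>"
    proof -
      have "V x - G x = (\<Sum>b\<in>Basis. ((F (x + \<rho> *\<^sub>R b) - F x) / \<rho> - G x \<bullet> b) *\<^sub>R b)"
        by (simp add: V_def scaleR_diff_left sum_subtractf euclidean_representation)
      also have "norm \<dots> \<le> (\<Sum>b\<in>(Basis::'a set). \<kappa>)"
        by (rule sum_norm_le)
          (simp add: difference_quotient_near_gradient[OF grad mod pos(1)])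
      finally show ?thesis by (simp add: n_def)
    qed
    have nk: "0 < n * \<kappa>" "\<kappa> \<le> n * \<kappa>"
      using n pos by auto
    \<comment> \<open>The claim reduces to \<open>(1 - 3 n \<kappa> / c) \<sigma> \<le> \<gamma> - n \<kappa>\<close>: the right side bounds \<open>G \<bullet> V / \<gamma>\<close> from below.\<close>
    have "\<sigma> x \<le> \<gamma> + 2 * n * \<kappa>"
      using \<sigma>le[of x] norm_triangle_sub[of "V x" "G x"] GV nk by (simp add: \<gamma>_def)
    moreover have "0 \<le> 1 - 3 * n * \<kappa> / c"
      using c by (simp add: divide_simps)
    ultimately have "(1 - 3 * n * \<kappa> / c) * \<sigma> x \<le> (1 - 3 * n * \<kappa> / c) * (\<gamma> + 2 * n * \<kappa>)"
      by (intro mult_left_mono) auto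
    also have "\<dots> \<le> \<gamma> - n * \<kappa>"
    proof -
      have "3 * n * \<kappa> / c * (\<gamma> + 2 * n * \<kappa>) \<ge> 3 * n * \<kappa> / c * c"
        using \<gamma> c nk by (intro mult_left_mono divide_nonneg_nonneg) linarith+
      then show ?thesis
        using c by (simp add: algebra_simps)
    qed
    finally have "(1 - 3 * n * \<kappa> / c) * \<sigma> x * \<gamma> \<le> (\<gamma> - n * \<kappa>) * \<gamma>"
      using \<gamma> c by (intro mult_right_mono) auto
    also have "\<dots> \<le> G x \<bullet> V x"
    proof -
      have "G x \<bullet> V x = \<gamma>\<^sup>2 + G x \<bullet> (V x - G x)"
        by (simp add: \<gamma>_def power2_norm_eq_inner inner_diff_right)
      moreover have "\<bar>G x \<bullet> (V x - G x)\<bar> \<le> \<gamma> * (n * \<kappa>)"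
        using Cauchy_Schwarz_ineq2 GV unfolding \<gamma>_def
        by (meson mult_left_mono norm_ge_zero order_trans)
      ultimately show ?thesis
        by (simp add: power2_eq_square algebra_simps)
    qed
    finally show ?thesis
      using \<sigma>pos[of x] by (simp add: T_def \<eta>1 \<gamma>_def field_simps)
  qed
  ultimately show thesis
    using normT by (intro that[of T]) (auto simp: n_def)
qed

section \<open>Flux and measure estimates near a level\<close>

lemma borel_superlevel:
  fixes F :: "'a::euclidean_space \<Rightarrow> real"
  assumes "continuous_on UNIV F"
  shows "{x. F x > h} \<in> sets borel"
  using assms by (intro borel_open open_Collect_less) auto

text \<open>The ramp vanishes at \<open>0\<close>, so the limit sees the strict superlevel set.\<close>

lemma tendsto_integral_ramp:
  fixes F :: "'a::euclidean_space \<Rightarrow> real"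
  assumes cF: "continuous_on UNIV F" and p: "integrable lborel p"
  shows "(\<lambda>j. LINT x|lborel. ramp (real j * (F x - h) + 0) * p x)
    \<longlonglongrightarrow> (LINT x|lborel. indicator {x. F x > h} x * p x)"
proof (rule integral_dominated_convergence[where w="\<lambda>x. norm (p x)"])
  have [measurable]: "p \<in> borel_measurable borel" "F \<in> borel_measurable borel"
    using p cF by (auto intro: borel_measurable_continuous_onI)
  have [measurable]: "{x. F x > h} \<in> sets borel"
    by (rule borel_superlevel[OF cF])
  show "(\<lambda>x. indicator {x. F x > h} x * p x) \<in> borel_measurable lborel"
    by simp
  show "(\<lambda>x. ramp (real j * (F x - h) + 0) * p x) \<in> borel_measurable lborel" for j
    by (intro borel_measurable_times) (auto intro!: borel_measurable_continuous_onI continuous_intros cF)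
  show "AE x in lborel. norm (ramp (real j * (F x - h) + 0) * p x) \<le> norm (p x)" for j
    by (rule AE_I2) (simp add: abs_mult ramp_bounds mult_left_le_one_le)
  show "AE x in lborel. (\<lambda>j. ramp (real j * (F x - h) + 0) * p x) \<longlonglongrightarrow> indicator {x. F x > h} x * p x"
  proof (rule AE_I2)
    fix x
    show "(\<lambda>j. ramp (real j * (F x - h) + 0) * p x) \<longlonglongrightarrow> indicator {x. F x > h} x * p x"
    proof (cases "F x > h")
      case True
      have "\<forall>\<^sub>F j in sequentially. 2 / (F x - h) \<le> real j"
        using filterlim_real_sequentially by (auto simp: filterlim_at_top)
      then have "\<forall>\<^sub>F j in sequentially. ramp (real j * (F x - h) + 0) * p x = p x"
        by (rule eventually_mono) (use True in \<open>auto simp: ramp_eq divide_simps\<close>)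
      then show ?thesis
        using True by (simp add: tendsto_eventually)
    next
      case False
      then have "ramp (real j * (F x - h) + 0) = 0" for j
        by (intro ramp_eq) (simp add: mult_nonneg_nonpos)
      then show ?thesis
        using False by simp
    qed
  qed
qed (use p in simp)

lemma integrable_divergence:
  assumes "T \<in> C1_test_fields B"
  shows "integrable lborel (divergence T)"
  using integral_divergence_by_parts(2)[OF assms, of "\<lambda>_. 1" "\<lambda>_. 0"] by (simp add: GDERIV_const)

text \<open>After replacing the indicator by a ramp in \<open>F\<close> and integrating by parts, both sides become
  integrals of \<open>- G \<bullet> S\<close> and \<open>- G \<bullet> T\<close> against the same nonnegative weight, which is concentrated
  on \<open>h < F < h + \<tau>\<close>; there \<open>(1 - k) (- G \<bullet> S) \<le> (1 - k) \<parallel>G\<parallel> \<le> - G \<bullet> T\<close>. Taking the supremum over \<open>S\<close>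
  bounds the perimeter of \<open>{F > h}\<close> by the flux of the single field \<open>T\<close>.\<close>

lemma superlevel_divergence_compare:
  fixes F :: "'a::euclidean_space \<Rightarrow> real" and k \<tau> h :: real
  assumes grad: "\<And>x. GDERIV F x :> G x" and contG: "continuous_on UNIV G"
    and T: "T \<in> C1_test_fields B" and S: "S \<in> C1_test_fields B" "\<And>x. norm (S x) \<le> 1"
    and k: "k \<le> 1" and "0 < \<tau>"
    and dir: "\<And>x. \<bar>F x - h\<bar> \<le> \<tau> \<Longrightarrow> (1 - k) * norm (G x) \<le> - (G x \<bullet> T x)"
  shows "(1 - k) * (LINT x|lborel. indicator {x. F x > h} x * divergence S x)
    \<le> (LINT x|lborel. indicator {x. F x > h} x * divergence T x)"
proof (rule LIMSEQ_le)
  note cF = continuous_on_GDERIV[OF grad]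
  define Q where "Q j x = (real j * hat (real j * (F x - h) + 0)) *\<^sub>R G x" for j x
  have gQ: "GDERIV (\<lambda>x. ramp (real j * (F x - h) + 0)) x :> Q j x" for j x
    unfolding Q_def by (rule GDERIV_ramp[OF grad])
  have cQ: "continuous_on UNIV (Q j)" for j
    unfolding Q_def by (intro continuous_intros cF contG)
  note T' = integral_divergence_by_parts[OF T gQ cQ] and S' = integral_divergence_by_parts[OF S(1) gQ cQ]
  show "(\<lambda>j. (1 - k) * (LINT x|lborel. ramp (real j * (F x - h) + 0) * divergence S x))
      \<longlonglongrightarrow> (1 - k) * (LINT x|lborel. indicator {x. F x > h} x * divergence S x)"
    by (intro tendsto_intros tendsto_integral_ramp cF integrable_divergence[OF S(1)])
  show "(\<lambda>j. LINT x|lborel. ramp (real j * (F x - h) + 0) * divergence T x)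
      \<longlonglongrightarrow> (LINT x|lborel. indicator {x. F x > h} x * divergence T x)"
    by (intro tendsto_integral_ramp cF integrable_divergence[OF T])
  obtain N :: nat where N: "2 / \<tau> < real N"
    using reals_Archimedean2 by blast
  have "(1 - k) * (LINT x|lborel. ramp (real j * (F x - h) + 0) * divergence S x)
      \<le> (LINT x|lborel. ramp (real j * (F x - h) + 0) * divergence T x)" if "j \<ge> N" for j
  proof -
    have "2 / \<tau> < real j"
      using N that by linarith
    then have j: "2 < real j * \<tau>"
      using \<open>0 < \<tau>\<close> by (simp add: pos_divide_less_eq)
    have j0: "0 < real j"
      using j by (cases "j = 0") auto
    have "(LINT x|lborel. (1 - k) * (- (Q j x \<bullet> S x))) \<le> (LINT x|lborel. - (Q j x \<bullet> T x))"
    proof (rule integral_mono)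
      fix x
      define y where "y = real j * (F x - h) + 0"
      show "(1 - k) * (- (Q j x \<bullet> S x)) \<le> - (Q j x \<bullet> T x)"
      proof (cases "0 < y \<and> y < 2")
        case True
        then have "0 < real j * (F x - h)" "real j * (F x - h) < real j * \<tau>"
          using j unfolding y_def by linarith+
        then have "h < F x" "F x - h < \<tau>"
          using j0 by (simp_all add: zero_less_mult_iff)
        then have "(1 - k) * norm (G x) \<le> - (G x \<bullet> T x)"
          using j0 by (intro dir) simp
        moreover have "- (G x \<bullet> S x) \<le> norm (G x)"
        proof -
          have "\<bar>G x \<bullet> S x\<bar> \<le> norm (G x) * 1"
            using Cauchy_Schwarz_ineq2[of "G x" "S x"] S(2)[of x]
            by (meson mult_left_mono norm_ge_zero order_trans)
          then show ?thesis by simp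
        qed
        then have "(1 - k) * (- (G x \<bullet> S x)) \<le> (1 - k) * norm (G x)"
          using k by (intro mult_left_mono) auto
        ultimately have "(1 - k) * (- (G x \<bullet> S x)) \<le> - (G x \<bullet> T x)"
          by simp
        then have "(real j * hat y) * ((1 - k) * (- (G x \<bullet> S x))) \<le> (real j * hat y) * (- (G x \<bullet> T x))"
          by (intro mult_left_mono) (auto simp: hat_bounds)
        then show ?thesis
          by (simp add: Q_def y_def mult_ac)
      next
        case False
        then have "hat y = 0"
          using hat_bounds(3,4) by force
        then show ?thesis
          by (simp add: Q_def y_def)
      qed
    qed (use T' S' in \<open>auto intro!: Bochner_Integration.integrable_minus integrable_mult_right\<close>)
    then show ?thesis
      unfolding T' S' by simp
  qed
  then show "\<exists>N. \<forall>j\<ge>N. (1 - k) * (LINT x|lborel. ramp (real j * (F x - h) + 0) * divergence S x)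
      \<le> (LINT x|lborel. ramp (real j * (F x - h) + 0) * divergence T x)"
    by blast
qed

text \<open>The slope of a ramp that climbs over \<open>h - 2t < F < h + 2t\<close> is at least \<open>1 / (4t)\<close> on the band
  \<open>\<bar>F - h\<bar> \<le> t\<close>, where moreover \<open>- G \<bullet> T \<ge> (1 - k) c\<close>. Integrating by parts, the measure of the band
  times \<open>(1 - k) c / (4t)\<close> is at most the integral of \<open>\<bar>div T\<bar>\<close> over \<open>B\<close>.\<close>

lemma level_band_measure:
  fixes F :: "'a::euclidean_space \<Rightarrow> real" and k \<tau> h c D t :: real
  assumes grad: "\<And>x. GDERIV F x :> G x" and contG: "continuous_on UNIV G"
    and T: "T \<in> C1_test_fields B" and D: "\<And>x. \<bar>divergence T x\<bar> \<le> D"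
    and k: "k < 1" and t: "0 < t" "2 * t \<le> \<tau>" and c: "0 < c"
    and dir: "\<And>x. \<bar>F x - h\<bar> \<le> \<tau> \<Longrightarrow> (1 - k) * norm (G x) \<le> - (G x \<bullet> T x)"
    and nondeg: "\<And>x. \<bar>F x - h\<bar> \<le> \<tau> \<Longrightarrow> c \<le> norm (G x)"
    and sub: "{x. F x \<ge> h - \<tau>} \<subseteq> B" and B: "bounded B" "B \<in> sets borel"
  shows "{x. \<bar>F x - h\<bar> \<le> t} \<in> sets borel"
    "measure lborel {x. \<bar>F x - h\<bar> \<le> t} \<le> 4 * D * measure lborel B / ((1 - k) * c) * t"
proof -
  note cF = continuous_on_GDERIV[OF grad]
  define A where "A = {x. \<bar>F x - h\<bar> \<le> t}"
  have "closed A"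
    unfolding A_def using cF by (intro closed_Collect_le continuous_intros) auto
  moreover have AB: "A \<subseteq> B"
    using sub t unfolding A_def by fastforce
  ultimately have "compact A"
    using B bounded_subset by (auto simp: compact_eq_bounded_closed)
  then have A: "A \<in> sets borel" "emeasure lborel A < \<infinity>"
    using emeasure_bounded_finite[OF compact_imp_bounded] by (auto simp: borel_compact)
  show "{x. \<bar>F x - h\<bar> \<le> t} \<in> sets borel"
    using A(1) by (simp add: A_def)
  have fB: "emeasure lborel B < \<infinity>"
    using emeasure_bounded_finite[OF B(1)] .
  define m where "m = 1 / (2 * t)"
  have m: "0 < m"
    using t by (simp add: m_def)
  define Q where "Q x = (m * hat (m * (F x - h) + 1)) *\<^sub>R G x" for x
  have gQ: "GDERIV (\<lambda>x. ramp (m * (F x - h) + 1)) x :> Q x" for x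
    unfolding Q_def by (rule GDERIV_ramp[OF grad])
  have cQ: "continuous_on UNIV Q"
    unfolding Q_def by (intro continuous_intros cF contG)
  note T' = integral_divergence_by_parts[OF T gQ cQ]
  define e where "e = (1 - k) * c * (m / 2)"
  have e: "e > 0"
    using k c m by (simp add: e_def)
  have "(LINT x|lborel. e * indicator A x) \<le> (LINT x|lborel. - (Q x \<bullet> T x))"
  proof (rule integral_mono)
    fix x
    define y where "y = m * (F x - h) + 1"
    show "e * indicator A x \<le> - (Q x \<bullet> T x)"
    proof (cases "0 < y \<and> y < 2")
      case True
      then have "\<bar>m * (F x - h)\<bar> \<le> 1"
        by (auto simp: y_def abs_le_iff)
      then have "\<bar>F x - h\<bar> \<le> 2 * t"
        using m t by (simp add: abs_mult m_def divide_simps)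
      then have *: "\<bar>F x - h\<bar> \<le> \<tau>"
        using t by linarith
      have "(1 - k) * c \<le> (1 - k) * norm (G x)"
        using k nondeg[OF *] by (intro mult_left_mono) auto
      then have **: "(1 - k) * c \<le> - (G x \<bullet> T x)"
        using dir[OF *] by linarith
      have "(1/2) * indicator A x \<le> hat y"
      proof (cases "x \<in> A")
        case True
        then have "\<bar>m * (F x - h)\<bar> \<le> 1/2"
          using t by (simp add: abs_mult m_def A_def divide_simps)
        then have "1/2 \<le> y" "y \<le> 3/2"
          unfolding y_def abs_le_iff by linarith+
        then show ?thesis
          using hat_bounds(5)[of y] True by simp
      qed (simp add: hat_bounds)
      then have "m * ((1/2) * indicator A x) * ((1 - k) * c) \<le> m * hat y * (- (G x \<bullet> T x))"
        using m k c hat_bounds(1)[of y] ** by (intro mult_mono mult_left_mono) auto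
      then show ?thesis
        by (simp add: Q_def y_def e_def mult_ac)
    next
      case False
      have "x \<notin> A"
      proof
        assume "x \<in> A"
        then have "\<bar>m * (F x - h)\<bar> \<le> 1/2"
          using t by (simp add: abs_mult m_def A_def divide_simps)
        then show False
          using False unfolding y_def abs_le_iff by linarith
      qed
      moreover have "hat y = 0"
        using False hat_bounds(3,4) by force
      ultimately show ?thesis
        by (simp add: Q_def y_def)
    qed
  qed (use A T' in \<open>auto intro!: integrable_mult_right integrable_real_indicator\<close>)
  also have "\<dots> = (LINT x|lborel. ramp (m * (F x - h) + 1) * divergence T x)"
    by (simp add: T')
  also have "\<dots> \<le> (LINT x|lborel. D * indicator B x)"
  proof (rule integral_mono)
    fix x
    have "\<bar>ramp (m * (F x - h) + 1) * divergence T x\<bar> \<le> 1 * \<bar>divergence T x\<bar>"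
      unfolding abs_mult using ramp_bounds[of "m * (F x - h) + 1"] by (intro mult_right_mono) auto
    then show "ramp (m * (F x - h) + 1) * divergence T x \<le> D * indicator B x"
      using D[of x] divergence_outside[OF T, of x] by (auto simp: indicator_def)
  qed (use fB B T' in \<open>auto intro!: integrable_mult_right integrable_real_indicator\<close>)
  finally have "e * measure lborel A \<le> D * measure lborel B"
    using A B fB by simp
  then have "measure lborel A \<le> D * measure lborel B / e"
    using e by (simp add: field_simps)
  also have "\<dots> = 4 * D * measure lborel B / ((1 - k) * c) * t"
    using k c t by (simp add: e_def m_def)
  finally show "measure lborel {x. \<bar>F x - h\<bar> \<le> t} \<le> 4 * D * measure lborel B / ((1 - k) * c) * t"
    by (simp add: A_def)
qed

lemma set_integral_superlevel_divergence:
  fixes F :: "'a::euclidean_space \<Rightarrow> real"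
  assumes "continuous_on UNIV F" "T \<in> C1_test_fields B"
  shows "(LINT x:B|lebesgue. indicator {x. F x > h} x * divergence T x)
    = (LINT x|lborel. indicator {x. F x > h} x * divergence T x)"
proof -
  have [measurable]: "{x. F x > h} \<in> sets borel" "divergence T \<in> borel_measurable borel"
    using borel_superlevel[OF assms(1)] continuous_on_divergence[OF assms(2)]
    by (auto intro: borel_measurable_continuous_onI)
  have "(LINT x:B|lebesgue. indicator {x. F x > h} x * divergence T x)
      = (LINT x|lebesgue. indicator {x. F x > h} x * divergence T x)"
    unfolding set_lebesgue_integral_def
    by (rule Bochner_Integration.integral_cong)
      (use divergence_outside[OF assms(2)] in \<open>auto simp: indicator_def\<close>)
  also have "\<dots> = (LINT x|lborel. indicator {x. F x > h} x * divergence T x)"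
    by (rule integral_completion) simp
  finally show ?thesis .
qed

lemma zero_test_field: "(\<lambda>_. 0) \<in> C1_test_fields B"
  by (rule C1_test_fieldsI[where T'="\<lambda>_ _. 0" and S="{}"]) auto

lemma total_variation_nonneg: "0 \<le> total_variation B v"
proof -
  have "divergence (\<lambda>_::'a. 0) = (\<lambda>_. 0)"
    using divergence_eq[OF has_derivative_const] by (auto simp: fun_eq_iff)
  then have "ereal (LINT x:B|lebesgue. v x * divergence (\<lambda>_. 0) x) = 0"
    by (simp add: set_lebesgue_integral_def)
  then show ?thesis
    unfolding total_variation_def
    by (intro SUP_upper2[of "\<lambda>_. 0"]) (auto simp: zero_test_field)
qed

text \<open>A finite bound on the fluxes lets the total variation be handled as a real number.\<close>

lemma real_total_variation_superlevel:
  fixes F :: "'a::euclidean_space \<Rightarrow> real"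
  assumes "continuous_on UNIV F"
    and bound: "\<And>S. S \<in> C1_test_fields B \<Longrightarrow> (\<And>x. norm (S x) \<le> 1) \<Longrightarrow>
      (LINT x|lborel. indicator {x. F x > h} x * divergence S x) \<le> M"
  defines "P \<equiv> total_variation B (indicator {x. F x > h})"
  shows "P < \<infinity>" "real_of_ereal P \<le> M"
    "\<And>S. S \<in> C1_test_fields B \<Longrightarrow> (\<And>x. norm (S x) \<le> 1) \<Longrightarrow>
      (LINT x|lborel. indicator {x. F x > h} x * divergence S x) \<le> real_of_ereal P"
proof -
  have le: "P \<le> ereal M"
    unfolding P_def total_variation_def
    by (intro SUP_least) (auto simp: set_integral_superlevel_divergence[OF assms(1)] bound)
  then show fin: "P < \<infinity>"
    by auto
  have nonneg: "0 \<le> P"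
    unfolding P_def by (rule total_variation_nonneg)
  have eq: "ereal (real_of_ereal P) = P"
    using fin nonneg by (cases P) auto
  show "real_of_ereal P \<le> M"
    using le eq by (metis ereal_less_eq(3))
  fix S assume S: "S \<in> C1_test_fields B" "\<And>x. norm (S x) \<le> 1"
  have "ereal (LINT x|lborel. indicator {x. F x > h} x * divergence S x) \<le> P"
    unfolding P_def total_variation_def
    by (rule SUP_upper2[of S]) (auto simp: set_integral_superlevel_divergence[OF assms(1) S(1)] S)
  then show "(LINT x|lborel. indicator {x. F x > h} x * divergence S x) \<le> real_of_ereal P"
    using eq by (metis ereal_less_eq(3))
qed

section \<open>Strict stability of superlevel sets\<close>

lemma superlevel_difference_le_band:
  fixes F1 F2 :: "'a \<Rightarrow> real"
  assumes "\<bar>F1 x - F2 x\<bar> \<le> t"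
  shows "\<bar>indicator {x. F1 x > h} x - indicator {x. F2 x > h} x :: real\<bar> \<le> indicator {x. \<bar>F1 x - h\<bar> \<le> t} x"
  using assms by (auto simp: indicator_def abs_le_iff)

text \<open>For each \<open>k\<close>, \<open>field\<close> provides almost normal fields with a divergence bound that is uniform in the
  family. The value \<open>k = 1/2\<close>, fixed once, already bounds all perimeters and the measure of thin
  bands; the precise comparison \<open>P_diff\<close> of two perimeters uses small \<open>k\<close>.\<close>

theorem superlevel_sets_strictly_stable:
  fixes \<F> :: "('a::euclidean_space \<Rightarrow> real) set" and L \<delta> c h a :: real
  assumes grad: "\<And>F x. F \<in> \<F> \<Longrightarrow> GDERIV F x :> gradient F x"
    and L: "\<And>F x. F \<in> \<F> \<Longrightarrow> norm (gradient F x) \<le> L"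
    and equi: "\<And>\<kappa>. 0 < \<kappa> \<Longrightarrow> \<exists>\<rho>>0. \<forall>F\<in>\<F>. \<forall>x y. norm (x - y) \<le> \<rho> \<longrightarrow>
      norm (gradient F x - gradient F y) \<le> \<kappa>"
    and pos: "0 < \<delta>" "0 < c" "0 < a"
    and nondeg: "\<And>F x. F \<in> \<F> \<Longrightarrow> \<bar>F x - h\<bar> \<le> \<delta> \<Longrightarrow> c \<le> norm (gradient F x)"
    and sub: "\<And>F. F \<in> \<F> \<Longrightarrow> {x. F x \<ge> h - \<delta>} \<subseteq> B" and B: "bounded B" "open B"
  shows "\<forall>F\<in>\<F>. indicator {x. F x > h} \<in> BV B"
    and "\<forall>\<epsilon>>0. \<exists>d>0. \<forall>F1\<in>\<F>. \<forall>F2\<in>\<F>. (\<forall>x. \<bar>F1 x - F2 x\<bar> \<le> d) \<longrightarrow>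
      d_st a B (indicator {x. F1 x > h}) (indicator {x. F2 x > h}) < \<epsilon>"
proof -
  have contG: "continuous_on UNIV (gradient F)" if "F \<in> \<F>" for F
    by (rule continuous_on_if_modulus) (use equi that in meson)
  note cF = continuous_on_GDERIV[OF grad]
  have mB: "B \<in> sets borel" and fB: "emeasure lborel B < \<infinity>"
    using B emeasure_bounded_finite by auto
  have field: "\<exists>D>0. \<forall>F\<in>\<F>. \<exists>T\<in>C1_test_fields B. (\<forall>x. norm (T x) \<le> 1) \<and> (\<forall>x. \<bar>divergence T x\<bar> \<le> D) \<and>
      (\<forall>x. \<bar>F x - h\<bar> \<le> \<delta> / 2 \<longrightarrow> (1 - k) * norm (gradient F x) \<le> - (gradient F x \<bullet> T x))"
    if k: "0 < k" "k \<le> 1" for k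
  proof -
    \<comment> \<open>Chosen so that the relative error \<open>3 n \<kappa> / c\<close> of the field is exactly \<open>k\<close>.\<close>
    define \<kappa> where "\<kappa> = k * c / (3 * DIM('a))"
    have \<kappa>: "0 < \<kappa>" "3 * DIM('a) * \<kappa> / c = k" "3 * DIM('a) * \<kappa> \<le> c"
      using k pos by (auto simp: \<kappa>_def mult_le_cancel_right1)
    obtain \<rho> where \<rho>: "\<rho> > 0" "\<And>F x y. F \<in> \<F> \<Longrightarrow> norm (x - y) \<le> \<rho> \<Longrightarrow> norm (gradient F x - gradient F y) \<le> \<kappa>"
      using equi[OF \<kappa>(1)] by metis
    \<comment> \<open>The maximum with \<open>1\<close> only makes \<open>D\<close> positive.\<close>
    define D where "D = max 1 (DIM('a) * (2 * DIM('a) / \<rho> + 4 * L / \<delta>))"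
    have "\<exists>T\<in>C1_test_fields B. (\<forall>x. norm (T x) \<le> 1) \<and> (\<forall>x. \<bar>divergence T x\<bar> \<le> D) \<and>
      (\<forall>x. \<bar>F x - h\<bar> \<le> \<delta> / 2 \<longrightarrow> (1 - k) * norm (gradient F x) \<le> - (gradient F x \<bullet> T x))" if F: "F \<in> \<F>" for F
    proof -
      obtain T where "T \<in> C1_test_fields B" "\<And>x. norm (T x) \<le> 1"
        "\<And>x. \<bar>divergence T x\<bar> \<le> DIM('a) * (2 * DIM('a) / \<rho> + 4 * L / \<delta>)"
        "\<And>x. \<bar>F x - h\<bar> \<le> \<delta> / 2 \<Longrightarrow> (1 - 3 * DIM('a) * \<kappa> / c) * norm (gradient F x) \<le> - (gradient F x \<bullet> T x)"
        using level_set_field[OF grad[OF F] contG[OF F] L[OF F] \<rho>(2)[OF F] \<rho>(1) \<kappa>(1) pos(1) \<kappa>(3) nondeg[OF F] sub[OF F] B(1)]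
        by blast
      then show ?thesis
        unfolding \<kappa>(2) by (intro bexI[of _ T]) (auto simp: D_def intro: max.coboundedI2)
    qed
    then show ?thesis
      by (intro exI[of _ D]) (auto simp: D_def)
  qed
  obtain D0 where D0: "D0 > 0" "\<And>F. F \<in> \<F> \<Longrightarrow> \<exists>T\<in>C1_test_fields B. (\<forall>x. norm (T x) \<le> 1) \<and> (\<forall>x. \<bar>divergence T x\<bar> \<le> D0) \<and>
      (\<forall>x. \<bar>F x - h\<bar> \<le> \<delta> / 2 \<longrightarrow> (1 - 1/2) * norm (gradient F x) \<le> - (gradient F x \<bullet> T x))"
    using field[of "1/2"] by auto
  define M where "M = 2 * (D0 * measure lborel B)"
  define Cb where "Cb = 4 * D0 * measure lborel B / ((1 - 1/2) * c)"
  have M0: "M \<ge> 0" "Cb \<ge> 0"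
    using D0(1) pos by (auto simp: M_def Cb_def)
  have band: "{x. \<bar>F x - h\<bar> \<le> t} \<in> sets borel" "emeasure lborel {x. \<bar>F x - h\<bar> \<le> t} < \<infinity>"
      "measure lborel {x. \<bar>F x - h\<bar> \<le> t} \<le> Cb * t"
    if F: "F \<in> \<F>" and t: "0 < t" "2 * t \<le> \<delta> / 2" for F t
  proof -
    obtain T where T: "T \<in> C1_test_fields B" "\<And>x. \<bar>divergence T x\<bar> \<le> D0"
      "\<And>x. \<bar>F x - h\<bar> \<le> \<delta> / 2 \<Longrightarrow> (1 - 1/2) * norm (gradient F x) \<le> - (gradient F x \<bullet> T x)"
      using D0(2)[OF F] by blast
    have s: "{x. F x \<ge> h - \<delta> / 2} \<subseteq> B"
      using sub[OF F] pos by force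
    have nd: "c \<le> norm (gradient F x)" if "\<bar>F x - h\<bar> \<le> \<delta> / 2" for x
      by (rule nondeg[OF F]) (use that pos in linarith)
    show "{x. \<bar>F x - h\<bar> \<le> t} \<in> sets borel" "measure lborel {x. \<bar>F x - h\<bar> \<le> t} \<le> Cb * t"
      using level_band_measure[OF grad[OF F] contG[OF F] T(1,2) _ t pos(2) T(3) nd s B(1) mB]
      by (auto simp: Cb_def)
    have "{x. \<bar>F x - h\<bar> \<le> t} \<subseteq> B"
      using s t by (auto simp: abs_le_iff)
    then show "emeasure lborel {x. \<bar>F x - h\<bar> \<le> t} < \<infinity>"
      using bounded_subset[OF B(1)] emeasure_bounded_finite by blast
  qed
  have flux: "(LINT x|lborel. indicator {x. F x > h} x * divergence S x) \<le> M"
    if F: "F \<in> \<F>" and S: "S \<in> C1_test_fields B" "\<And>x. norm (S x) \<le> 1" for F S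
  proof -
    obtain T where T: "T \<in> C1_test_fields B" "\<And>x. \<bar>divergence T x\<bar> \<le> D0"
      "\<And>x. \<bar>F x - h\<bar> \<le> \<delta> / 2 \<Longrightarrow> (1 - 1/2) * norm (gradient F x) \<le> - (gradient F x \<bullet> T x)"
      using D0(2)[OF F] by blast
    have "(1 - 1/2) * (LINT x|lborel. indicator {x. F x > h} x * divergence S x)
        \<le> (LINT x|lborel. indicator {x. F x > h} x * divergence T x)"
      by (rule superlevel_divergence_compare[where \<tau>="\<delta> / 2", OF grad[OF F] contG[OF F] T(1) S _ _ T(3)]) (use pos in auto)
    also have "\<dots> \<le> (LINT x|lborel. D0 * indicator B x)"
    proof (rule integral_mono)
      show "integrable lborel (\<lambda>x. indicator {x. F x > h} x * divergence T x)"
        using integrable_mult_indicator[OF _ integrable_divergence[OF T(1)]] borel_superlevel[OF cF[OF F]] by simp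
      show "indicator {x. F x > h} x * divergence T x \<le> D0 * indicator B x" for x
        using T(2)[of x] D0(1) divergence_outside[OF T(1), of x] by (auto simp: indicator_def)
    qed (use fB mB in \<open>auto intro!: integrable_mult_right integrable_real_indicator\<close>)
    finally show ?thesis
      using mB fB by (simp add: M_def)
  qed
  define P where "P F = real_of_ereal (total_variation B (indicator {x. F x > h}))" for F :: "'a \<Rightarrow> real"
  have tv: "total_variation B (indicator {x. F x > h}) < \<infinity>" "P F \<le> M"
    "\<And>S. S \<in> C1_test_fields B \<Longrightarrow> (\<And>x. norm (S x) \<le> 1) \<Longrightarrow>
      (LINT x|lborel. indicator {x. F x > h} x * divergence S x) \<le> P F" if F: "F \<in> \<F>" for F
  proof -
    note r = real_total_variation_superlevel[OF cF[OF F], of B h M, folded P_def]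
    show "total_variation B (indicator {x. F x > h}) < \<infinity>"
      by (rule r(1)) (rule flux[OF F])
    show "P F \<le> M"
      by (rule r(2)) (rule flux[OF F])
    show "(LINT x|lborel. indicator {x. F x > h} x * divergence S x) \<le> P F"
      if "S \<in> C1_test_fields B" "\<And>x. norm (S x) \<le> 1" for S
      by (rule r(3)) (rule flux[OF F], use that in auto)
  qed
  show "\<forall>F\<in>\<F>. indicator {x. F x > h} \<in> BV B"
  proof
    fix F assume F: "F \<in> \<F>"
    have "set_integrable lborel B (indicator {x. F x > h} :: 'a \<Rightarrow> real)"
      unfolding set_integrable_def
      using integrable_mult_indicator[of "{x. F x > h}" lborel "\<lambda>x. indicator B x :: real"]
        borel_superlevel[OF cF[OF F]] mB fB
      by (simp add: integrable_real_indicator mult.commute)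
    then have "set_integrable lebesgue B (indicator {x. F x > h} :: 'a \<Rightarrow> real)"
      unfolding set_integrable_def by (rule integrable_completion[THEN iffD2, rotated]) (use borel_superlevel[OF cF[OF F]] mB in simp)
    then show "indicator {x. F x > h} \<in> BV B"
      using tv(1)[OF F] by (simp add: BV_def)
  qed
  have P_diff: "P F1 \<le> P F2 + (k * M + D * (Cb * t))"
    if F: "F1 \<in> \<F>" "F2 \<in> \<F>" and close: "\<And>x. \<bar>F1 x - F2 x\<bar> \<le> t" and t: "0 < t" "2 * t \<le> \<delta> / 2"
      and k: "0 < k" "k < 1" and D: "0 < D"
      and T: "T \<in> C1_test_fields B" "\<And>x. norm (T x) \<le> 1" "\<And>x. \<bar>divergence T x\<bar> \<le> D"
      "\<And>x. \<bar>F1 x - h\<bar> \<le> \<delta> / 2 \<Longrightarrow> (1 - k) * norm (gradient F1 x) \<le> - (gradient F1 x \<bullet> T x)"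
    for F1 F2 k D t T
  proof -
    let ?A = "{x. \<bar>F1 x - h\<bar> \<le> t}"
    note bd = band[OF F(1) t]
    have int: "integrable lborel (\<lambda>x. indicator {x. F x > h} x * divergence T x)" if "F \<in> \<F>" for F
      using integrable_mult_indicator[OF _ integrable_divergence[OF T(1)]] borel_superlevel[OF cF[OF that]] by simp
    let ?I = "\<lambda>F. LINT x|lborel. indicator {x. F x > h} x * divergence T x"
    have "?I F1 - ?I F2 = (LINT x|lborel. indicator {x. F1 x > h} x * divergence T x - indicator {x. F2 x > h} x * divergence T x)"
      using int F by simp
    also have "\<dots> \<le> (LINT x|lborel. D * indicator ?A x)"
    proof (rule integral_mono)
      fix x
      have "\<bar>(indicator {x. F1 x > h} x - indicator {x. F2 x > h} x) * divergence T x\<bar> \<le> indicator ?A x * D"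
        unfolding abs_mult using superlevel_difference_le_band[of F1 x F2 t h] close[of x] T(3) by (intro mult_mono) auto
      then show "indicator {x. F1 x > h} x * divergence T x - indicator {x. F2 x > h} x * divergence T x \<le> D * indicator ?A x"
        by (simp add: left_diff_distrib[symmetric] mult.commute[of D] abs_le_iff)
    qed (use int F bd in \<open>auto intro!: integrable_mult_right integrable_real_indicator\<close>)
    also have "\<dots> = D * measure lborel ?A"
      using bd by simp
    also have "\<dots> \<le> D * (Cb * t)"
      using bd D by (intro mult_left_mono) auto
    finally have 1: "?I F1 \<le> P F2 + D * (Cb * t)"
      using tv(3)[OF F(2) T(1,2)] by simp
    have "P F1 \<le> ?I F1 / (1 - k)"
    proof (rule real_total_variation_superlevel(2)[OF cF[OF F(1)], of B h, folded P_def])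
      fix S assume S: "S \<in> C1_test_fields B" "\<And>x. norm (S x) \<le> 1"
      have "(1 - k) * (LINT x|lborel. indicator {x. F1 x > h} x * divergence S x) \<le> ?I F1"
        by (rule superlevel_divergence_compare[where \<tau>="\<delta> / 2", OF grad[OF F(1)] contG[OF F(1)] T(1) S _ _ T(4)]) (use k pos in auto)
      then show "(LINT x|lborel. indicator {x. F1 x > h} x * divergence S x) \<le> ?I F1 / (1 - k)"
        using k by (simp add: pos_le_divide_eq mult.commute)
    qed
    then have "P F1 - k * P F1 \<le> ?I F1"
      using k by (simp add: pos_le_divide_eq algebra_simps)
    moreover have "k * P F1 \<le> k * M"
      using tv(2)[OF F(1)] k by (intro mult_left_mono) auto
    ultimately show ?thesis
      using 1 by linarith
  qed
  show "\<forall>\<epsilon>>0. \<exists>d>0. \<forall>F1\<in>\<F>. \<forall>F2\<in>\<F>. (\<forall>x. \<bar>F1 x - F2 x\<bar> \<le> d) \<longrightarrow>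
      d_st a B (indicator {x. F1 x > h}) (indicator {x. F2 x > h}) < \<epsilon>"
  proof (intro allI impI)
    fix \<epsilon> :: real assume \<epsilon>: "\<epsilon> > 0"
    have cancel: "\<epsilon> / (m * X) * X = \<epsilon> / m" if "X > 0" for m X :: real
      using that by simp
    have aM: "a * M + 1 > 0"
      using pos M0 by (simp add: add_nonneg_pos)
    \<comment> \<open>First \<open>k\<close>, which fixes the divergence bound \<open>D\<close>; only then the admissible distance \<open>t\<close>.\<close>
    define k where "k = min (1/2) (\<epsilon> / (4 * (a * M + 1)))"
    have k: "0 < k" "k < 1"
      using \<epsilon> aM by (auto simp: k_def)
    have "k * (a * M + 1) \<le> \<epsilon> / 4"
    proof -
      have "k * (a * M + 1) \<le> \<epsilon> / (4 * (a * M + 1)) * (a * M + 1)"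
        using aM by (intro mult_right_mono) (auto simp: k_def)
      also have "\<dots> = \<epsilon> / 4"
        by (rule cancel[OF aM])
      finally show ?thesis .
    qed
    then have kM: "a * (k * M) \<le> \<epsilon> / 4"
      using k by (simp add: algebra_simps)
    obtain D where D: "D > 0" "\<And>F. F \<in> \<F> \<Longrightarrow> \<exists>T\<in>C1_test_fields B. (\<forall>x. norm (T x) \<le> 1) \<and> (\<forall>x. \<bar>divergence T x\<bar> \<le> D) \<and>
      (\<forall>x. \<bar>F x - h\<bar> \<le> \<delta> / 2 \<longrightarrow> (1 - k) * norm (gradient F x) \<le> - (gradient F x \<bullet> T x))"
      using field[of k] k by auto
    \<comment> \<open>\<open>E t\<close> bounds the \<open>L\<^sup>1\<close> part and the flux part of the distance together.\<close>
    define E where "E = Cb * (1 + a * D)"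
    have E: "E \<ge> 0"
      using M0 pos D(1) by (simp add: E_def)
    define t where "t = min (\<delta> / 4) (\<epsilon> / (2 * (E + 1)))"
    have t: "0 < t" "2 * t \<le> \<delta> / 2"
      using \<epsilon> pos E by (auto simp: t_def)
    have "t * (E + 1) \<le> \<epsilon> / (2 * (E + 1)) * (E + 1)"
      using E by (intro mult_right_mono) (auto simp: t_def)
    also have "\<dots> = \<epsilon> / 2"
      using E by (intro cancel) simp
    finally have tE: "Cb * t + a * (D * (Cb * t)) \<le> \<epsilon> / 2"
      using t by (simp add: E_def algebra_simps)
    have "d_st a B (indicator {x. F1 x > h}) (indicator {x. F2 x > h}) < \<epsilon>"
      if F: "F1 \<in> \<F>" "F2 \<in> \<F>" and close: "\<And>x. \<bar>F1 x - F2 x\<bar> \<le> t" for F1 F2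
    proof -
      have close': "\<bar>F2 x - F1 x\<bar> \<le> t" for x
        using close[of x] by (simp add: abs_minus_commute)
      obtain T1 T2 where T1: "T1 \<in> C1_test_fields B" "\<And>x. norm (T1 x) \<le> 1" "\<And>x. \<bar>divergence T1 x\<bar> \<le> D"
          "\<And>x. \<bar>F1 x - h\<bar> \<le> \<delta> / 2 \<Longrightarrow> (1 - k) * norm (gradient F1 x) \<le> - (gradient F1 x \<bullet> T1 x)"
        and T2: "T2 \<in> C1_test_fields B" "\<And>x. norm (T2 x) \<le> 1" "\<And>x. \<bar>divergence T2 x\<bar> \<le> D"
          "\<And>x. \<bar>F2 x - h\<bar> \<le> \<delta> / 2 \<Longrightarrow> (1 - k) * norm (gradient F2 x) \<le> - (gradient F2 x \<bullet> T2 x)"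
        using D(2)[OF F(1)] D(2)[OF F(2)] by blast
      have "\<bar>P F1 - P F2\<bar> \<le> k * M + D * (Cb * t)"
        using P_diff[OF F close t k D(1) T1] P_diff[OF F(2,1) close' t k D(1) T2] by linarith
      then have "a * \<bar>P F1 - P F2\<bar> \<le> a * (k * M + D * (Cb * t))"
        using pos by (intro mult_left_mono) auto
      then have 1: "a * \<bar>P F1 - P F2\<bar> \<le> a * (k * M) + a * (D * (Cb * t))"
        by (simp add: distrib_left)
      note bd = band[OF F(1) t]
      note [measurable] = bd(1) mB borel_superlevel[OF cF[OF F(1)], of h] borel_superlevel[OF cF[OF F(2)], of h]
      have "(LINT x:B|lebesgue. \<bar>indicator {x. F1 x > h} x - indicator {x. F2 x > h} x\<bar> :: real)
          = (LINT x|lborel. indicator B x * \<bar>indicator {x. F1 x > h} x - indicator {x. F2 x > h} x\<bar> :: real)"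
        unfolding set_lebesgue_integral_def real_scaleR_def by (rule integral_completion) simp
      also have "\<dots> \<le> (LINT x|lborel. indicator {x. \<bar>F1 x - h\<bar> \<le> t} x)"
      proof (rule integral_mono')
        show "indicator B x * \<bar>indicator {x. F1 x > h} x - indicator {x. F2 x > h} x\<bar> \<le> (indicator {x. \<bar>F1 x - h\<bar> \<le> t} x :: real)" for x
          using superlevel_difference_le_band[of F1 x F2 t h] close[of x] by (cases "x \<in> B") auto
      qed (use bd in \<open>auto intro!: integrable_real_indicator\<close>)
      also have "\<dots> \<le> Cb * t"
        using bd by simp
      finally show ?thesis
        using 1 tE kM \<epsilon> by (simp add: d_st_def P_def[symmetric])
    qed
    then show "\<exists>d>0. \<forall>F1\<in>\<F>. \<forall>F2\<in>\<F>. (\<forall>x. \<bar>F1 x - F2 x\<bar> \<le> d) \<longrightarrow>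
      d_st a B (indicator {x. F1 x > h}) (indicator {x. F2 x > h}) < \<epsilon>"
      using t by blast
  qed
qed

section \<open>The imaging operator as a bounded quadratic form\<close>

lemma borel_measurable_lebesgue_continuous:
  fixes f :: "'a::euclidean_space \<Rightarrow> 'b::topological_space"
  assumes "continuous_on UNIV f"
  shows "f \<in> borel_measurable lebesgue"
  by (rule measurable_completion) (simp add: borel_measurable_continuous_onI assms)

lemma le_norm_if_le: "x \<le> y \<Longrightarrow> x \<le> norm (y::real)"
  by simp

lemma fourier_transform_continuous_bounded:
  fixes g :: "'a::euclidean_space \<Rightarrow> real"
  assumes g: "integrable lebesgue g"
  shows "continuous_on UNIV (fourier_transform g)"
    and "norm (fourier_transform g x) \<le> (LINT y|lebesgue. \<bar>g y\<bar>)"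
proof -
  define p where "p x y = exp (- (\<i> * complex_of_real (x \<bullet> y))) * complex_of_real (g y)" for x y
  have np: "norm (p x y) = \<bar>g y\<bar>" for x y
    by (simp add: p_def norm_mult)
  have mg: "(\<lambda>y. complex_of_real (g y)) \<in> borel_measurable lebesgue"
    using borel_measurable_integrable[OF g] by measurable
  have mp: "p x \<in> borel_measurable lebesgue" for x
    unfolding p_def
    by (intro borel_measurable_times mg borel_measurable_lebesgue_continuous continuous_intros)
  have ig: "integrable lebesgue (\<lambda>y. \<bar>g y\<bar>)"
    using g by simp
  have "norm (fourier_transform g x) \<le> (LINT y|lebesgue. norm (p x y))"
    unfolding fourier_transform_def p_def by (rule integral_norm_bound)
  then show "norm (fourier_transform g x) \<le> (LINT y|lebesgue. \<bar>g y\<bar>)"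
    by (simp add: np)
  show "continuous_on UNIV (fourier_transform g)"
  proof (rule continuous_at_imp_continuous_on, rule ballI)
    fix x
    show "isCont (fourier_transform g) x"
      unfolding continuous_at_sequentially comp_def
    proof (intro allI impI)
      fix s :: "nat \<Rightarrow> 'a" assume s: "s \<longlonglongrightarrow> x"
      have "(\<lambda>n. LINT y|lebesgue. p (s n) y) \<longlonglongrightarrow> (LINT y|lebesgue. p x y)"
      proof (rule integral_dominated_convergence[OF mp mp ig])
        show "AE y in lebesgue. (\<lambda>n. p (s n) y) \<longlonglongrightarrow> p x y"
          unfolding p_def by (intro AE_I2 tendsto_intros s)
      qed (simp add: np)
      then show "(\<lambda>n. fourier_transform g (s n)) \<longlonglongrightarrow> fourier_transform g x"
        unfolding fourier_transform_def p_def .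
    qed
  qed
qed

definition coherence_form ::
  "('a::euclidean_space \<Rightarrow> complex) \<Rightarrow> ('a \<Rightarrow> complex) \<Rightarrow> ('a \<Rightarrow> complex) \<Rightarrow> complex" where
  "coherence_form J U V = (LINT \<eta>|lebesgue. LINT \<xi>|lebesgue. U \<xi> * J (\<xi> - \<eta>) * V \<eta>)"

text \<open>The intensity at \<open>x\<close> is this form on the diagonal, at \<open>p = q = K (x - \<cdot>)\<close>. Keeping the two arguments
  apart, in the Banach space of bounded continuous functions, makes the product rule applicable.\<close>

definition imaging_form ::
  "('a::euclidean_space \<Rightarrow> complex) \<Rightarrow> ('a \<Rightarrow> real) \<Rightarrow> ('a \<Rightarrow>\<^sub>C complex) \<Rightarrow> ('a \<Rightarrow>\<^sub>C complex) \<Rightarrow> real" where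
  "imaging_form J u p q = Re (coherence_form J
    (\<lambda>\<xi>. complex_of_real (u \<xi>) * p \<xi>) (\<lambda>\<eta>. cnj (q \<eta>) * complex_of_real (u \<eta>)))"

context
  fixes J :: "'a::euclidean_space \<Rightarrow> complex" and M :: real
  assumes cJ: "continuous_on UNIV J" and bJ: "\<And>x. norm (J x) \<le> M"
begin

lemma coherence_inner_integrable:
  assumes "integrable lebesgue U"
  shows "integrable lebesgue (\<lambda>\<xi>. U \<xi> * J (\<xi> - \<eta>))"
proof (rule Bochner_Integration.integrable_bound)
  show "integrable lebesgue (\<lambda>\<xi>. M * norm (U \<xi>))"
    using assms by simp
  show "(\<lambda>\<xi>. U \<xi> * J (\<xi> - \<eta>)) \<in> borel_measurable lebesgue"
    using assms by (intro borel_measurable_times borel_measurable_integrable[OF assms]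
        borel_measurable_lebesgue_continuous continuous_on_compose2[OF cJ] continuous_intros) auto
  have le: "norm (U \<xi> * J (\<xi> - \<eta>)) \<le> M * norm (U \<xi>)" for \<xi>
    unfolding norm_mult by (subst mult.commute) (intro mult_right_mono bJ norm_ge_zero)
  show "AE \<xi> in lebesgue. norm (U \<xi> * J (\<xi> - \<eta>)) \<le> norm (M * norm (U \<xi>))"
    by (intro AE_I2 le_norm_if_le le)
qed

lemma coherence_inner_bound:
  assumes "integrable lebesgue U"
  shows "norm (LINT \<xi>|lebesgue. U \<xi> * J (\<xi> - \<eta>)) \<le> M * (LINT \<xi>|lebesgue. norm (U \<xi>))"
proof -
  have "norm (LINT \<xi>|lebesgue. U \<xi> * J (\<xi> - \<eta>)) \<le> (LINT \<xi>|lebesgue. norm (U \<xi> * J (\<xi> - \<eta>)))"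
    by (rule integral_norm_bound)
  also have "\<dots> \<le> (LINT \<xi>|lebesgue. M * norm (U \<xi>))"
  proof (rule integral_mono)
    show "norm (U \<xi> * J (\<xi> - \<eta>)) \<le> M * norm (U \<xi>)" for \<xi>
      unfolding norm_mult by (subst mult.commute) (intro mult_right_mono bJ norm_ge_zero)
  qed (use assms coherence_inner_integrable in auto)
  finally show ?thesis by simp
qed

text \<open>Continuity in \<open>\<eta>\<close> is what makes the outer integrand measurable.\<close>

lemma coherence_inner_continuous:
  assumes U: "integrable lebesgue U"
  shows "continuous_on UNIV (\<lambda>\<eta>. LINT \<xi>|lebesgue. U \<xi> * J (\<xi> - \<eta>))"
proof (rule continuous_at_imp_continuous_on, rule ballI)
  fix \<eta>
  show "isCont (\<lambda>\<eta>. LINT \<xi>|lebesgue. U \<xi> * J (\<xi> - \<eta>)) \<eta>"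
    unfolding continuous_at_sequentially comp_def
  proof (intro allI impI)
    fix s :: "nat \<Rightarrow> 'a" assume s: "s \<longlonglongrightarrow> \<eta>"
    show "(\<lambda>n. LINT \<xi>|lebesgue. U \<xi> * J (\<xi> - s n)) \<longlonglongrightarrow> (LINT \<xi>|lebesgue. U \<xi> * J (\<xi> - \<eta>))"
    proof (rule integral_dominated_convergence[where w="\<lambda>\<xi>. M * norm (U \<xi>)"])
      have "(\<lambda>n. J (\<xi> - s n)) \<longlonglongrightarrow> J (\<xi> - \<eta>)" for \<xi>
        by (rule continuous_on_tendsto_compose[OF cJ]) (auto intro!: tendsto_intros s)
      then show "AE \<xi> in lebesgue. (\<lambda>n. U \<xi> * J (\<xi> - s n)) \<longlonglongrightarrow> U \<xi> * J (\<xi> - \<eta>)"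
        by (intro AE_I2 tendsto_intros)
      show "AE \<xi> in lebesgue. norm (U \<xi> * J (\<xi> - s n)) \<le> M * norm (U \<xi>)" for n
        unfolding norm_mult by (subst mult.commute) (intro AE_I2 mult_right_mono bJ norm_ge_zero)
    qed (use U coherence_inner_integrable in \<open>auto intro: borel_measurable_integrable\<close>)
  qed
qed

lemma coherence_form_eq:
  "coherence_form J U V = (LINT \<eta>|lebesgue. (LINT \<xi>|lebesgue. U \<xi> * J (\<xi> - \<eta>)) * V \<eta>)"
  unfolding coherence_form_def by simp

lemma coherence_outer_integrable:
  assumes U: "integrable lebesgue U" and V: "integrable lebesgue V"
  shows "integrable lebesgue (\<lambda>\<eta>. (LINT \<xi>|lebesgue. U \<xi> * J (\<xi> - \<eta>)) * V \<eta>)"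
proof (rule Bochner_Integration.integrable_bound)
  show "integrable lebesgue (\<lambda>\<eta>. (M * (LINT \<xi>|lebesgue. norm (U \<xi>))) * norm (V \<eta>))"
    using V by (intro integrable_mult_right) auto
  show "(\<lambda>\<eta>. (LINT \<xi>|lebesgue. U \<xi> * J (\<xi> - \<eta>)) * V \<eta>) \<in> borel_measurable lebesgue"
    using V by (intro borel_measurable_times borel_measurable_integrable[OF V]
        borel_measurable_lebesgue_continuous coherence_inner_continuous U)
  have le: "norm ((LINT \<xi>|lebesgue. U \<xi> * J (\<xi> - \<eta>)) * V \<eta>)
      \<le> (M * (LINT \<xi>|lebesgue. norm (U \<xi>))) * norm (V \<eta>)" for \<eta>
    unfolding norm_mult by (intro mult_right_mono coherence_inner_bound U norm_ge_zero)
  show "AE \<eta> in lebesgue. norm ((LINT \<xi>|lebesgue. U \<xi> * J (\<xi> - \<eta>)) * V \<eta>)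
      \<le> norm ((M * (LINT \<xi>|lebesgue. norm (U \<xi>))) * norm (V \<eta>))"
    by (intro AE_I2 le_norm_if_le le)
qed

text \<open>Separating the two integrations turns \<open>coherence_form\<close> into a bounded bilinear form on \<open>L\<^sup>1\<close>, with \<open>M\<close>,
  a bound for \<open>J\<close>, as its constant.\<close>

lemma coherence_form_bound:
  assumes U: "integrable lebesgue U" and V: "integrable lebesgue V"
  shows "norm (coherence_form J U V) \<le> M * (LINT \<xi>|lebesgue. norm (U \<xi>)) * (LINT \<eta>|lebesgue. norm (V \<eta>))"
proof -
  have "norm (coherence_form J U V) \<le> (LINT \<eta>|lebesgue. norm ((LINT \<xi>|lebesgue. U \<xi> * J (\<xi> - \<eta>)) * V \<eta>))"
    unfolding coherence_form_eq by (rule integral_norm_bound)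
  also have "\<dots> \<le> (LINT \<eta>|lebesgue. (M * (LINT \<xi>|lebesgue. norm (U \<xi>))) * norm (V \<eta>))"
  proof (rule integral_mono)
    show "norm ((LINT \<xi>|lebesgue. U \<xi> * J (\<xi> - \<eta>)) * V \<eta>)
      \<le> (M * (LINT \<xi>|lebesgue. norm (U \<xi>))) * norm (V \<eta>)" for \<eta>
      unfolding norm_mult by (intro mult_right_mono coherence_inner_bound U norm_ge_zero)
    show "integrable lebesgue (\<lambda>\<eta>. norm ((LINT \<xi>|lebesgue. U \<xi> * J (\<xi> - \<eta>)) * V \<eta>))"
      by (rule integrable_norm[OF coherence_outer_integrable[OF U V]])
    show "integrable lebesgue (\<lambda>\<eta>. (M * (LINT \<xi>|lebesgue. norm (U \<xi>))) * norm (V \<eta>))"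
      using V by (intro integrable_mult_right) auto
  qed
  also have "\<dots> = M * (LINT \<xi>|lebesgue. norm (U \<xi>)) * (LINT \<eta>|lebesgue. norm (V \<eta>))"
    by simp
  finally show ?thesis .
qed

lemma coherence_form_add_left:
  assumes "integrable lebesgue U" "integrable lebesgue U'" "integrable lebesgue V"
  shows "coherence_form J (\<lambda>\<xi>. U \<xi> + U' \<xi>) V = coherence_form J U V + coherence_form J U' V"
  unfolding coherence_form_eq
  using assms coherence_inner_integrable coherence_outer_integrable
  by (simp add: distrib_right)

lemma coherence_form_add_right:
  assumes "integrable lebesgue U" "integrable lebesgue V" "integrable lebesgue V'"
  shows "coherence_form J U (\<lambda>\<eta>. V \<eta> + V' \<eta>) = coherence_form J U V + coherence_form J U V'"
  unfolding coherence_form_eq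
  using assms coherence_outer_integrable
  by (simp add: distrib_left)

lemma coherence_form_scale:
  "coherence_form J (\<lambda>\<xi>. r * U \<xi>) V = r * coherence_form J U V"
  "coherence_form J U (\<lambda>\<eta>. r * V \<eta>) = r * coherence_form J U V"
  unfolding coherence_form_eq by (simp_all add: mult.assoc mult.left_commute[of _ r])

lemma integrable_mult_bcontfun:
  fixes p :: "'a \<Rightarrow>\<^sub>C complex"
  assumes u: "integrable lebesgue u"
  shows "integrable lebesgue (\<lambda>\<xi>. complex_of_real (u \<xi>) * p \<xi>)"
    and "integrable lebesgue (\<lambda>\<eta>. cnj (p \<eta>) * complex_of_real (u \<eta>))"
    and "(LINT \<xi>|lebesgue. norm (complex_of_real (u \<xi>) * p \<xi>)) \<le> norm p * (LINT \<xi>|lebesgue. \<bar>u \<xi>\<bar>)"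
proof -
  have i: "integrable lebesgue (\<lambda>\<xi>. norm p * \<bar>u \<xi>\<bar>)"
    using u by simp
  have le: "norm (complex_of_real (u \<xi>) * p \<xi>) \<le> norm p * \<bar>u \<xi>\<bar>" for \<xi>
    unfolding norm_mult norm_of_real by (subst mult.commute) (intro mult_right_mono norm_bounded abs_ge_zero)
  have mu: "(\<lambda>\<xi>. complex_of_real (u \<xi>)) \<in> borel_measurable lebesgue"
    using borel_measurable_integrable[OF u] by measurable
  show 1: "integrable lebesgue (\<lambda>\<xi>. complex_of_real (u \<xi>) * p \<xi>)"
  proof (rule Bochner_Integration.integrable_bound[OF i])
    show "(\<lambda>\<xi>. complex_of_real (u \<xi>) * p \<xi>) \<in> borel_measurable lebesgue"
      by (intro borel_measurable_times mu borel_measurable_lebesgue_continuous continuous_on_apply_bcontfun)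
    show "AE \<xi> in lebesgue. norm (complex_of_real (u \<xi>) * p \<xi>) \<le> norm (norm p * \<bar>u \<xi>\<bar>)"
      by (intro AE_I2 le_norm_if_le le)
  qed
  have "integrable lebesgue (\<lambda>\<xi>. cnj (complex_of_real (u \<xi>) * p \<xi>))"
    using 1 by (simp only: integrable_cnj)
  then show "integrable lebesgue (\<lambda>\<eta>. cnj (p \<eta>) * complex_of_real (u \<eta>))"
    by (simp add: mult.commute)
  show "(LINT \<xi>|lebesgue. norm (complex_of_real (u \<xi>) * p \<xi>)) \<le> norm p * (LINT \<xi>|lebesgue. \<bar>u \<xi>\<bar>)"
    using integral_mono[OF integrable_norm[OF 1] i le] by simp
qed

lemma coherence_form_bcontfun_bound:
  fixes p q :: "'a \<Rightarrow>\<^sub>C complex"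
  assumes u: "integrable lebesgue u" and v: "integrable lebesgue v"
  shows "norm (coherence_form J (\<lambda>\<xi>. complex_of_real (u \<xi>) * p \<xi>) (\<lambda>\<eta>. cnj (q \<eta>) * complex_of_real (v \<eta>)))
    \<le> M * (LINT \<xi>|lebesgue. \<bar>u \<xi>\<bar>) * (LINT \<xi>|lebesgue. \<bar>v \<xi>\<bar>) * norm p * norm q"
proof -
  have M: "0 \<le> M"
    using bJ norm_ge_zero order_trans by blast
  have eq: "(LINT \<eta>|lebesgue. norm (cnj (q \<eta>) * complex_of_real (v \<eta>))) = (LINT \<eta>|lebesgue. norm (complex_of_real (v \<eta>) * q \<eta>))"
    by (simp add: norm_mult mult.commute)
  have "norm (coherence_form J (\<lambda>\<xi>. complex_of_real (u \<xi>) * p \<xi>) (\<lambda>\<eta>. cnj (q \<eta>) * complex_of_real (v \<eta>)))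
    \<le> M * (LINT \<xi>|lebesgue. norm (complex_of_real (u \<xi>) * p \<xi>)) * (LINT \<eta>|lebesgue. norm (complex_of_real (v \<eta>) * q \<eta>))"
    using coherence_form_bound[OF integrable_mult_bcontfun(1)[OF u] integrable_mult_bcontfun(2)[OF v], of p q] unfolding eq .
  also have "\<dots> \<le> M * (norm p * (LINT \<xi>|lebesgue. \<bar>u \<xi>\<bar>)) * (norm q * (LINT \<xi>|lebesgue. \<bar>v \<xi>\<bar>))"
    using M integrable_mult_bcontfun(3)[OF u, of p] integrable_mult_bcontfun(3)[OF v, of q]
    by (intro mult_mono mult_left_mono) (auto intro!: mult_nonneg_nonneg)
  finally show ?thesis
    by (simp add: mult_ac)
qed

lemma imaging_form_bound:
  assumes u: "integrable lebesgue u"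
  shows "\<bar>imaging_form J u p q\<bar> \<le> norm p * norm q * (M * (LINT \<xi>|lebesgue. \<bar>u \<xi>\<bar>)\<^sup>2)"
proof -
  have "\<bar>imaging_form J u p q\<bar> \<le> norm (coherence_form J (\<lambda>\<xi>. complex_of_real (u \<xi>) * p \<xi>) (\<lambda>\<eta>. cnj (q \<eta>) * complex_of_real (u \<eta>)))"
    unfolding imaging_form_def by (rule abs_Re_le_cmod)
  then show ?thesis
    using coherence_form_bcontfun_bound[OF u u, of p q] by (simp add: power2_eq_square mult_ac)
qed

lemma bounded_bilinear_imaging_form:
  assumes u: "integrable lebesgue u"
  shows "bounded_bilinear (imaging_form J u)"
proof
  note i = integrable_mult_bcontfun[OF u]
  show "imaging_form J u (p + p') q = imaging_form J u p q + imaging_form J u p' q" for p p' q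
    using coherence_form_add_left[OF i(1) i(1) i(2), of p p' q]
    by (simp add: imaging_form_def distrib_left)
  show "imaging_form J u p (q + q') = imaging_form J u p q + imaging_form J u p q'" for p q q'
    using coherence_form_add_right[OF i(1) i(2) i(2), of p q q']
    by (simp add: imaging_form_def distrib_right)
  show "imaging_form J u (r *\<^sub>R p) q = r *\<^sub>R imaging_form J u p q" for r p q
    using coherence_form_scale(1)[of "complex_of_real r" "\<lambda>\<xi>. complex_of_real (u \<xi>) * p \<xi>"]
    by (simp add: imaging_form_def scaleR_conv_of_real mult.left_commute)
  show "imaging_form J u p (r *\<^sub>R q) = r *\<^sub>R imaging_form J u p q" for r p q
    using coherence_form_scale(2)[of _ "complex_of_real r" "\<lambda>\<eta>. cnj (q \<eta>) * complex_of_real (u \<eta>)"]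
    by (simp add: imaging_form_def scaleR_conv_of_real mult.assoc)
  show "\<exists>C. \<forall>p q. norm (imaging_form J u p q) \<le> norm p * norm q * C"
    using imaging_form_bound[OF u] by auto
qed

text \<open>Changing one of the two occurrences of the mask at a time leaves \<open>u - v\<close> as a factor.\<close>

lemma imaging_form_diff_mask:
  assumes u: "integrable lebesgue u" and v: "integrable lebesgue v"
  shows "\<bar>imaging_form J u p p - imaging_form J v p p\<bar>
    \<le> M * ((LINT \<xi>|lebesgue. \<bar>u \<xi>\<bar>) + (LINT \<xi>|lebesgue. \<bar>v \<xi>\<bar>)) * (norm p)\<^sup>2 * (LINT \<xi>|lebesgue. \<bar>u \<xi> - v \<xi>\<bar>)"
proof -
  let ?l = "\<lambda>u \<xi>. complex_of_real (u \<xi>) * p \<xi>" and ?r = "\<lambda>u \<eta>. cnj (p \<eta>) * complex_of_real (u \<eta>)"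
  let ?w = "\<lambda>\<xi>. u \<xi> - v \<xi>"
  have w: "integrable lebesgue ?w"
    using u v by simp
  note i = integrable_mult_bcontfun
  have "coherence_form J (?l u) (?r u) = coherence_form J (?l ?w) (?r u) + coherence_form J (?l v) (?r u)"
    using coherence_form_add_left[OF i(1)[OF w] i(1)[OF v] i(2)[OF u], of p p p] by (simp add: algebra_simps)
  moreover have "coherence_form J (?l v) (?r u) = coherence_form J (?l v) (?r ?w) + coherence_form J (?l v) (?r v)"
    using coherence_form_add_right[OF i(1)[OF v] i(2)[OF w] i(2)[OF v], of p p p] by (simp add: algebra_simps)
  ultimately have eq: "imaging_form J u p p - imaging_form J v p p
      = Re (coherence_form J (?l ?w) (?r u)) + Re (coherence_form J (?l v) (?r ?w))"
    unfolding imaging_form_def by simp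
  have "\<bar>imaging_form J u p p - imaging_form J v p p\<bar> \<le> norm (coherence_form J (?l ?w) (?r u)) + norm (coherence_form J (?l v) (?r ?w))"
    unfolding eq by (intro order_trans[OF abs_triangle_ineq] add_mono abs_Re_le_cmod)
  also have "\<dots> \<le> M * (LINT \<xi>|lebesgue. \<bar>?w \<xi>\<bar>) * (LINT \<xi>|lebesgue. \<bar>u \<xi>\<bar>) * norm p * norm p
      + M * (LINT \<xi>|lebesgue. \<bar>v \<xi>\<bar>) * (LINT \<xi>|lebesgue. \<bar>?w \<xi>\<bar>) * norm p * norm p"
    by (rule add_mono[OF coherence_form_bcontfun_bound[OF w u, of p p] coherence_form_bcontfun_bound[OF v w, of p p]])
  also have "\<dots> = M * ((LINT \<xi>|lebesgue. \<bar>u \<xi>\<bar>) + (LINT \<xi>|lebesgue. \<bar>v \<xi>\<bar>)) * (norm p)\<^sup>2 * (LINT \<xi>|lebesgue. \<bar>?w \<xi>\<bar>)"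
    unfolding power2_eq_square by (simp only: distrib_left distrib_right mult_ac)
  finally show ?thesis .
qed

end

text \<open>Translation of \<open>K\<close>, as a map into bounded continuous functions, inherits the regularity of \<open>K\<close>
  because all the estimates for \<open>K\<close> hold with constants that do not depend on the point.\<close>

lemma C1_hoelder_translates:
  fixes K :: "'a::real_normed_vector \<Rightarrow> complex"
  assumes "C1_hoelder \<alpha> K" and \<alpha>: "0 < \<alpha>"
  obtains T :: "'a \<Rightarrow> 'a \<Rightarrow>\<^sub>C complex" and T' :: "'a \<Rightarrow> 'a \<Rightarrow> 'a \<Rightarrow>\<^sub>C complex" and k H :: real
  where "0 \<le> k" "0 \<le> H" "\<And>x \<xi>. apply_bcontfun (T x) \<xi> = K (x - \<xi>)"
    "\<And>x. (T has_derivative T' x) (at x)" "\<And>x. norm (T x) \<le> k" "\<And>x w. norm (T' x w) \<le> k * norm w"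
    "\<And>x y. norm (T x - T y) \<le> k * norm (x - y)"
    "\<And>x y w. norm (T' x w - T' y w) \<le> H * norm (x - y) powr \<alpha> * norm w"
proof -
  obtain K' :: "'a \<Rightarrow> 'a \<Rightarrow>\<^sub>L complex" and H0 where K': "\<And>x. (K has_derivative blinfun_apply (K' x)) (at x)"
    and b: "bounded (range K)" "bounded (range K')"
    and H0: "\<And>x y. norm (K' x - K' y) \<le> H0 * norm (x - y) powr \<alpha>"
    using assms(1) unfolding C1_hoelder_def by blast
  obtain k1 k2 where k1: "\<And>x. norm (K x) \<le> k1" and k2: "\<And>x. norm (K' x) \<le> k2"
    using b unfolding bounded_iff by auto
  define k where "k = max k1 k2"
  define H where "H = max 0 H0"
  have k: "norm (K x) \<le> k" "norm (K' x) \<le> k" for x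
    using k1[of x] k2[of x] by (auto simp: k_def)
  have k0: "0 \<le> k"
    using k(1) norm_ge_zero order_trans by blast
  have H: "norm (K' x - K' y) \<le> H * norm (x - y) powr \<alpha>" for x y
    by (rule order_trans[OF H0]) (auto intro!: mult_right_mono simp: H_def)
  have cK: "continuous_on UNIV K"
    by (meson K' UNIV_I continuous_at_imp_continuous_on has_derivative_continuous)
  have cK': "continuous_on UNIV K'"
  proof (rule continuous_at_imp_continuous_on, rule ballI)
    fix x :: 'a
    have "((\<lambda>y. norm (y - x)) \<longlongrightarrow> norm (x - x)) (at x)"
      by (intro tendsto_intros)
    then have "((\<lambda>y. norm (y - x) powr \<alpha>) \<longlongrightarrow> 0 powr \<alpha>) (at x)"
      by (intro tendsto_powr') (use \<alpha> in auto)
    from tendsto_mult[OF tendsto_const[of H] this]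
    have "((\<lambda>y. H * norm (y - x) powr \<alpha>) \<longlongrightarrow> 0) (at x)"
      by simp
    then have "((\<lambda>y. K' y - K' x) \<longlongrightarrow> 0) (at x)"
      by (rule Lim_null_comparison[rotated]) (simp add: H)
    then show "isCont K' x"
      by (simp add: isCont_def LIM_zero_iff)
  qed
  define T where "T x = Bcontfun (\<lambda>\<xi>. K (x - \<xi>))" for x
  define T' where "T' x w = Bcontfun (\<lambda>\<xi>. blinfun_apply (K' (x - \<xi>)) w)" for x w
  have T: "apply_bcontfun (T x) \<xi> = K (x - \<xi>)" for x \<xi>
    unfolding T_def
    by (subst Bcontfun_inverse, rule bcontfun_normI[OF continuous_on_compose2[OF cK] k(1)])
      (auto intro!: continuous_intros)
  have n': "norm (blinfun_apply (K' x) w) \<le> k * norm w" for x w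
    by (rule order_trans[OF norm_blinfun]) (intro mult_right_mono k norm_ge_zero)
  have T': "apply_bcontfun (T' x w) \<xi> = blinfun_apply (K' (x - \<xi>)) w" for x w \<xi>
    unfolding T'_def
    by (subst Bcontfun_inverse, rule bcontfun_normI[OF _ n'])
      (auto intro!: continuous_intros continuous_on_compose2[OF cK'])
  have blT': "bounded_linear (T' x)" for x
  proof (rule bounded_linear_intro[where K=k])
    show "T' x (v + w) = T' x v + T' x w" for v w
      by (rule bcontfun_eqI) (simp add: T' blinfun.add_right)
    show "T' x (r *\<^sub>R v) = r *\<^sub>R T' x v" for r v
      by (rule bcontfun_eqI) (simp add: T' blinfun.scaleR_right)
    show "norm (T' x v) \<le> norm v * k" for v
      by (rule norm_bound) (simp add: T' n' mult.commute[of _ k])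
  qed
  have der: "(T has_derivative T' x) (at x)" for x
  proof (rule has_derivative_from_powr_remainder[OF blT' \<alpha>])
    fix w :: 'a
    show "norm (T (x + w) - T x - T' x w) \<le> H * norm w * norm w powr \<alpha>"
    proof (rule norm_bound)
      fix \<xi>
      define y where "y = x - \<xi>"
      have y: "x + w - \<xi> = y + w" "x - \<xi> = y"
        by (simp_all add: y_def)
      have "norm (K (y + w) - K y - blinfun_apply (K' y) ((y + w) - y)) \<le> norm ((y + w) - y) * (H * norm w powr \<alpha>)"
      proof (rule differentiable_bound_linearization[where S="cball y (norm w)"])
        show "y + t *\<^sub>R (y + w - y) \<in> cball y (norm w)" if "t \<in> {0..1}" for t
          using that by (auto simp: dist_norm mult_left_le_one_le)
        show "(K has_derivative blinfun_apply (K' z)) (at z within cball y (norm w))" for z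
          using K' has_derivative_at_withinI by blast
        show "onorm (blinfun_apply (K' z) - blinfun_apply (K' y)) \<le> H * norm w powr \<alpha>" if "z \<in> cball y (norm w)" for z
        proof -
          have "blinfun_apply (K' z) - blinfun_apply (K' y) = blinfun_apply (K' z - K' y)"
            by (auto simp: blinfun.diff_left)
          then have "onorm (blinfun_apply (K' z) - blinfun_apply (K' y)) \<le> H * norm (z - y) powr \<alpha>"
            using H by (simp add: norm_blinfun.rep_eq[symmetric])
          also have "\<dots> \<le> H * norm w powr \<alpha>"
            using that \<alpha> by (intro mult_left_mono powr_mono2) (auto simp: dist_norm norm_minus_commute H_def)
          finally show ?thesis .
        qed
      qed auto
      then show "norm (apply_bcontfun (T (x + w) - T x - T' x w) \<xi>) \<le> H * norm w * norm w powr \<alpha>"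
        by (simp add: T T' y mult_ac)
    qed
  qed
  have lip: "norm (T x - T y) \<le> k * norm (x - y)" for x y
  proof (rule differentiable_bound[where S=UNIV and f'=T'])
    show "onorm (T' x) \<le> k" for x
      by (rule onorm_bound[OF k0], rule norm_bound) (simp add: T' n')
  qed (use der in auto)
  show thesis
  proof (rule that[of k H T T'])
    show "norm (T' x w - T' y w) \<le> H * norm (x - y) powr \<alpha> * norm w" for x y w
    proof (rule norm_bound)
      fix \<xi>
      have "norm (blinfun_apply (K' (x - \<xi>)) w - blinfun_apply (K' (y - \<xi>)) w) \<le> norm (K' (x - \<xi>) - K' (y - \<xi>)) * norm w"
        unfolding blinfun.diff_left[symmetric] by (rule norm_blinfun)
      also have "\<dots> \<le> H * norm ((x - \<xi>) - (y - \<xi>)) powr \<alpha> * norm w"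
        by (intro mult_right_mono H norm_ge_zero)
      finally show "norm (apply_bcontfun (T' x w - T' y w) \<xi>) \<le> H * norm (x - y) powr \<alpha> * norm w"
        by (simp add: T')
    qed
  qed (use k0 T der lip k n' in \<open>auto simp: H_def T T' intro!: norm_bound\<close>)
qed

text \<open>The product rule for a bounded bilinear map. The three bounds involve \<open>\<Phi>\<close> only through its
  constant \<open>A\<close>, hence they are uniform over all masks.\<close>

lemma imaged_gradient:
  fixes T :: "'a::euclidean_space \<Rightarrow> 'a \<Rightarrow>\<^sub>C complex" and u :: "'a \<Rightarrow> real" and \<Phi>
  assumes bil: "bounded_bilinear \<Phi>" and bound: "\<And>p q. \<bar>\<Phi> p q\<bar> \<le> norm p * norm q * A" and A: "0 \<le> A"
    and k: "0 \<le> k" and H: "0 \<le> H"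
    and der: "\<And>x. (T has_derivative T' x) (at x)" and T: "\<And>x. norm (T x) \<le> k" and T': "\<And>x w. norm (T' x w) \<le> k * norm w"
    and lip: "\<And>x y. norm (T x - T y) \<le> k * norm (x - y)"
    and hoel: "\<And>x y w. norm (T' x w - T' y w) \<le> H * norm (x - y) powr \<alpha> * norm w"
  defines "F \<equiv> \<lambda>x. \<Phi> (T x) (T x)"
  shows "GDERIV F x :> gradient F x" "norm (gradient F x) \<le> 2 * A * k * k"
    "norm (gradient F x - gradient F y) \<le> 2 * A * k * (k * norm (x - y) + H * norm (x - y) powr \<alpha>)"
proof -
  interpret bounded_bilinear \<Phi>
    by (rule bil)
  have Fder: "(F has_derivative (\<lambda>w. \<Phi> (T x) (T' x w) + \<Phi> (T' x w) (T x))) (at x)" for x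
    unfolding F_def by (rule FDERIV[OF der der])
  note G = gradient_eq[OF Fder]
  show "GDERIV F x :> gradient F x"
    by (rule G)
  have bd: "\<bar>\<Phi> p q\<bar> \<le> P * Q * A" if "norm p \<le> P" "norm q \<le> Q" for p q P Q
  proof -
    have "0 \<le> P"
      using that(1) norm_ge_zero order_trans by blast
    then have "norm p * norm q * A \<le> P * Q * A"
      using that A by (intro mult_right_mono mult_mono) auto
    then show ?thesis
      using bound[of p q] by linarith
  qed
  show "norm (gradient F x) \<le> 2 * A * k * k"
  proof (rule norm_le_if_inner_le, use A k H in simp)
    fix w :: 'a
    have "\<bar>\<Phi> (T x) (T' x w) + \<Phi> (T' x w) (T x)\<bar> \<le> k * (k * norm w) * A + (k * norm w) * k * A"
      by (intro order_trans[OF abs_triangle_ineq] add_mono bd T T')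
    then show "\<bar>w \<bullet> gradient F x\<bar> \<le> 2 * A * k * k * norm w"
      unfolding G(2) by (simp add: mult_ac)
  qed
  show "norm (gradient F x - gradient F y) \<le> 2 * A * k * (k * norm (x - y) + H * norm (x - y) powr \<alpha>)"
  proof (rule norm_le_if_inner_le, use A k H in simp)
    fix w :: 'a
    define r where "r = H * norm (x - y) powr \<alpha> * norm w"
    have "w \<bullet> (gradient F x - gradient F y) = (\<Phi> (T x - T y) (T' x w) + \<Phi> (T y) (T' x w - T' y w))
        + (\<Phi> (T' x w) (T x - T y) + \<Phi> (T' x w - T' y w) (T y))"
      unfolding inner_diff_right G(2) by (simp add: diff_left diff_right)
    also have "\<bar>\<dots>\<bar> \<le> (k * norm (x - y) * (k * norm w) * A + k * r * A) + ((k * norm w) * (k * norm (x - y)) * A + r * k * A)"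
      unfolding r_def by (intro order_trans[OF abs_triangle_ineq] add_mono bd T T' lip hoel)
    finally show "\<bar>w \<bullet> (gradient F x - gradient F y)\<bar>
        \<le> 2 * A * k * (k * norm (x - y) + H * norm (x - y) powr \<alpha>) * norm w"
      by (simp add: r_def algebra_simps)
  qed
qed

section \<open>The regularized masks\<close>

text \<open>If \<open>s\<close> is negative at a point, it is negative on an open set, which has positive measure and on
  which the integrand is infinite.\<close>

lemma nonneg_if_finite_barrier_integral:
  fixes s :: "'a::euclidean_space \<Rightarrow> real" and f :: "real \<Rightarrow> ennreal"
  assumes s: "continuous_on UNIV s" and f: "continuous_on UNIV f" "\<And>t. t \<le> 0 \<Longrightarrow> f t = \<infinity>"
    and fin: "(\<integral>\<^sup>+ x. f (s x) \<partial>lebesgue) < \<infinity>"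
  shows "0 \<le> s x"
proof -
  have "(\<lambda>x. f (s x)) \<in> borel_measurable lebesgue"
    by (intro borel_measurable_lebesgue_continuous continuous_on_compose2[OF f(1) s]) auto
  then have "AE x in lebesgue. f (s x) \<noteq> \<infinity>"
    using fin by (intro nn_integral_PInf_AE) auto
  then have "AE x in lebesgue. x \<in> {x. 0 \<le> s x}"
  proof (rule eventually_mono)
    show "x \<in> {x. 0 \<le> s x}" if "f (s x) \<noteq> \<infinity>" for x
      using that f(2)[of "s x"] by (cases "s x \<le> 0") auto
  qed
  moreover have "closed {x. 0 \<le> s x}"
    using s by (intro closed_Collect_le) auto
  ultimately show ?thesis
    using mem_closed_if_AE_lebesgue by blast
qed

lemma masks_integral_bound:
  assumes "u \<in> masks R"
  shows "integrable lebesgue u" "(LINT x|lebesgue. \<bar>u x\<bar>) \<le> measure lebesgue (ball 0 R :: (real^2) set)"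
proof -
  show u: "integrable lebesgue u"
    using assms by (simp add: masks_def)
  have "(LINT x|lebesgue. \<bar>u x\<bar>) \<le> (LINT x|lebesgue. indicator (ball 0 R :: (real^2) set) x)"
  proof (rule integral_mono_AE)
    have "AE x in lebesgue. 0 \<le> u x \<and> u x \<le> 1" "AE x in lebesgue. x \<notin> ball 0 R \<longrightarrow> u x = 0"
      using assms by (auto simp: masks_def)
    then show "AE x in lebesgue. \<bar>u x\<bar> \<le> indicator (ball 0 R) x"
      by eventually_elim (auto simp: indicator_def)
    show "integrable lebesgue (indicator (ball 0 R) :: real^2 \<Rightarrow> real)"
      using lmeasurable_ball[of "0::real^2" R] by (intro integrable_real_indicator) (auto simp: fmeasurable_def)
  qed (use u in simp)
  then show "(LINT x|lebesgue. \<bar>u x\<bar>) \<le> measure lebesgue (ball 0 R :: (real^2) set)"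
    by simp
qed

lemma intensity_eq_imaging_form:
  assumes "\<And>x \<xi>. apply_bcontfun (T x) \<xi> = K (x - \<xi>)"
  shows "intensity K J u = (\<lambda>x. imaging_form J u (T x) (T x))"
  by (rule ext) (simp add: intensity_def imaging_form_def coherence_form_def assms mult.assoc)

theorem lemma3p7:
  fixes R \<alpha> h \<delta>\<^sub>0 \<delta> c\<^sub>1 C\<^sub>0 R\<^sub>1 a C :: real
    and K J :: "real^2 \<Rightarrow> complex" and g :: "real^2 \<Rightarrow> real"
    and f :: "real \<Rightarrow> ennreal" and L :: ennreal and \<phi> :: "real \<Rightarrow> real"
  assumes "R > 0" and "0 < \<alpha>" and "\<alpha> \<le> 1"
    and "C1_hoelder \<alpha> K" and "(K \<longlongrightarrow> 0) at_infinity"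
    and "integrable lebesgue g" and "AE x in lebesgue. 0 \<le> g x" and "J = fourier_transform g"
    and "h > 0"
    and "\<delta>\<^sub>0 > 0"
    and "continuous_on UNIV f" and "antimono f"
    and "\<And>s. s \<le> 0 \<Longrightarrow> f s = \<infinity>" and "\<And>s. \<delta>\<^sub>0 \<le> s \<Longrightarrow> f s = 0"
    and "C\<^sub>0 > 0" and "((\<lambda>s. f s * ennreal (s powr (2 / \<alpha>))) \<longlongrightarrow> L) (at_right 0)"
    and "ennreal C\<^sub>0 \<le> L"
    and "\<phi> C1_differentiable_on UNIV" and "\<phi> h > 0"
    and "mono_on {..h} \<phi>" and "antimono_on {h..} \<phi>" and "\<phi> 0 < - \<delta>\<^sub>0"
    and "\<delta> > 0" and "c\<^sub>1 > 0" and "\<And>s. s \<in> {h - \<delta>..h + \<delta>} \<Longrightarrow> c\<^sub>1 \<le> \<phi> s"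
    and "\<phi> 0 \<le> - (\<delta>\<^sub>0 + \<delta>)"
    and "R\<^sub>1 \<ge> R"
    and "\<And>u. u \<in> masks R \<Longrightarrow> {x. intensity K J u x \<ge> h - \<delta>} \<subseteq> ball 0 R\<^sub>1"
    and "\<And>u x. u \<in> masks R \<Longrightarrow> norm x \<ge> R\<^sub>1 \<Longrightarrow>
           (norm (gradient (intensity K J u) x))\<^sup>2 - \<phi> (intensity K J u x) \<ge> \<delta>\<^sub>0"
    and "a > 0"
    and "C > 0"
  shows "(\<forall>u \<in> regular_masks R K J f \<phi> C. wafer K J h u \<in> BV (ball 0 (R\<^sub>1 + 1))) \<and>
         (\<forall>\<epsilon>>0. \<exists>d>0. \<forall>u \<in> regular_masks R K J f \<phi> C. \<forall>v \<in> regular_masks R K J f \<phi> C.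
            L1_dist u v < d \<longrightarrow>
            d_st a (ball 0 (R\<^sub>1 + 1)) (wafer K J h u) (wafer K J h v) < \<epsilon>)"
proof -
  define M where "M = (LINT y|lebesgue. \<bar>g y\<bar>)"
  have cJ: "continuous_on UNIV J" and bJ: "norm (J x) \<le> M" for x
    using fourier_transform_continuous_bounded[OF assms(6)] by (auto simp: \<open>J = fourier_transform g\<close> M_def)
  have M: "0 \<le> M"
    by (simp add: M_def)
  define N where "N = measure lebesgue (ball 0 R :: (real^2) set)"
  have N: "0 \<le> N"
    by (simp add: N_def)
  obtain T :: "real^2 \<Rightarrow> (real^2) \<Rightarrow>\<^sub>C complex" and T' k H where
    k: "0 \<le> k" and H: "0 \<le> H" and TK: "\<And>x \<xi>. apply_bcontfun (T x) \<xi> = K (x - \<xi>)"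
    and T: "\<And>x. (T has_derivative T' x) (at x)" "\<And>x. norm (T x) \<le> k" "\<And>x w. norm (T' x w) \<le> k * norm w"
    "\<And>x y. norm (T x - T y) \<le> k * norm (x - y)"
    "\<And>x y w. norm (T' x w - T' y w) \<le> H * norm (x - y) powr \<alpha> * norm w"
    using C1_hoelder_translates[OF \<open>C1_hoelder \<alpha> K\<close> \<open>0 < \<alpha>\<close>] by metis
  note int_eq = intensity_eq_imaging_form[of T K J, OF TK]
  \<comment> \<open>A common bound of the forms \<open>imaging_form J u\<close>, because a mask has \<open>L\<^sup>1\<close> norm at most \<open>N\<close>.\<close>
  define A where "A = M * N\<^sup>2"
  have A: "0 \<le> A"
    using M by (simp add: A_def)
  have form: "bounded_bilinear (imaging_form J u)" "\<bar>imaging_form J u p q\<bar> \<le> norm p * norm q * A"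
    if u: "u \<in> masks R" for u p q
  proof -
    note mu = masks_integral_bound[OF u, folded N_def]
    show "bounded_bilinear (imaging_form J u)"
      by (rule bounded_bilinear_imaging_form[OF cJ bJ mu(1)])
    have "M * (LINT \<xi>|lebesgue. \<bar>u \<xi>\<bar>)\<^sup>2 \<le> A"
      unfolding A_def using M mu(2) by (intro mult_left_mono power_mono) auto
    then have "norm p * norm q * (M * (LINT \<xi>|lebesgue. \<bar>u \<xi>\<bar>)\<^sup>2) \<le> norm p * norm q * A"
      by (intro mult_left_mono) auto
    then show "\<bar>imaging_form J u p q\<bar> \<le> norm p * norm q * A"
      using imaging_form_bound[OF cJ bJ mu(1), of p q] by linarith
  qed
  define G where "G u = gradient (intensity K J u)" for u
  have grad: "GDERIV (intensity K J u) x :> G u x" "norm (G u x) \<le> 2 * A * k * k"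
    "norm (G u x - G u y) \<le> 2 * A * k * (k * norm (x - y) + H * norm (x - y) powr \<alpha>)"
    if u: "u \<in> masks R" for u x y
    unfolding G_def int_eq
    using imaged_gradient[OF form[OF u] A k H T] by blast+
  have modulus: "\<exists>\<rho>>0. \<forall>u\<in>masks R. \<forall>x y. norm (x - y) \<le> \<rho> \<longrightarrow> norm (G u x - G u y) \<le> \<kappa>" if \<kappa>: "0 < \<kappa>" for \<kappa>
  proof -
    let ?\<omega> = "\<lambda>s. 2 * A * k * (k * s + H * s powr \<alpha>)"
    have "((\<lambda>s. s powr \<alpha>) \<longlongrightarrow> 0 powr \<alpha>) (at_right 0)"
      by (rule tendsto_powr') (use \<open>0 < \<alpha>\<close> in \<open>auto simp: eventually_at_right_less intro: tendsto_intros eventually_mono[OF eventually_at_right_less]\<close>)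
    then have "((\<lambda>s. s powr \<alpha>) \<longlongrightarrow> 0) (at_right 0)"
      by simp
    then have "(?\<omega> \<longlongrightarrow> 2 * A * k * (k * 0 + H * 0)) (at_right 0)"
      by (intro tendsto_intros)
    then have "\<forall>\<^sub>F s in at_right 0. ?\<omega> s < \<kappa>"
      using \<kappa> by (intro order_tendstoD) auto
    then obtain b where b: "b > 0" "\<And>s. 0 < s \<Longrightarrow> s < b \<Longrightarrow> ?\<omega> s < \<kappa>"
      by (auto simp: eventually_at_right_field)
    have "norm (G u x - G u y) \<le> \<kappa>" if u: "u \<in> masks R" and xy: "norm (x - y) \<le> b / 2" for u x y
    proof -
      have "?\<omega> (norm (x - y)) \<le> ?\<omega> (b / 2)"
        using A k H xy \<open>0 < \<alpha>\<close> by (intro mult_left_mono add_mono powr_mono2 mult_nonneg_nonneg) auto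
      then show ?thesis
        using grad(3)[OF u, of x y] b(2)[of "b / 2"] b(1) by linarith
    qed
    then show ?thesis
      using b(1) by (intro exI[of _ "b / 2"]) auto
  qed
  have nonneg: "0 \<le> (norm (G u x))\<^sup>2 - \<phi> (intensity K J u x)" if u: "u \<in> regular_masks R K J f \<phi> C" for u x
  proof (rule nonneg_if_finite_barrier_integral[where f=f and s="\<lambda>x. (norm (G u x))\<^sup>2 - \<phi> (intensity K J u x)"])
    have m: "u \<in> masks R"
      using u by (simp add: regular_masks_def)
    have "continuous_on UNIV (G u)"
      by (rule continuous_on_if_modulus) (use modulus m in meson)
    moreover have "continuous_on UNIV (\<lambda>x. \<phi> (intensity K J u x))"
      by (rule continuous_on_compose2[OF C1_differentiable_imp_continuous_on[OF \<open>\<phi> C1_differentiable_on UNIV\<close>]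
            continuous_on_GDERIV[OF grad(1)[OF m]]]) auto
    ultimately show "continuous_on UNIV (\<lambda>x. (norm (G u x))\<^sup>2 - \<phi> (intensity K J u x))"
      by (intro continuous_intros)
    show "(\<integral>\<^sup>+ x. f ((norm (G u x))\<^sup>2 - \<phi> (intensity K J u x)) \<partial>lebesgue) < \<infinity>"
      using u by (auto simp: regular_masks_def regularizer_def G_def intro: le_less_trans)
  qed (use assms in auto)
  have nondeg: "sqrt c\<^sub>1 \<le> norm (G u x)"
    if u: "u \<in> regular_masks R K J f \<phi> C" and x: "\<bar>intensity K J u x - h\<bar> \<le> \<delta>" for u x
  proof -
    have "c\<^sub>1 \<le> \<phi> (intensity K J u x)"
      using x by (intro assms(25)) (auto simp: abs_le_iff)
    then have "c\<^sub>1 \<le> (norm (G u x))\<^sup>2"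
      using nonneg[OF u, of x] by linarith
    then show ?thesis
      by (simp add: real_le_lsqrt)
  qed
  let ?B = "ball 0 (R\<^sub>1 + 1) :: (real^2) set"
  let ?\<F> = "intensity K J ` regular_masks R K J f \<phi> C"
  have reg: "u \<in> masks R" if "u \<in> regular_masks R K J f \<phi> C" for u
    using that by (simp add: regular_masks_def)
  have stable: "\<forall>F\<in>?\<F>. indicator {x. F x > h} \<in> BV ?B"
    "\<forall>\<epsilon>>0. \<exists>d>0. \<forall>F1\<in>?\<F>. \<forall>F2\<in>?\<F>. (\<forall>x. \<bar>F1 x - F2 x\<bar> \<le> d) \<longrightarrow>
      d_st a ?B (indicator {x. F1 x > h}) (indicator {x. F2 x > h}) < \<epsilon>"
  proof -
    have F: "GDERIV F x :> gradient F x" "norm (gradient F x) \<le> 2 * A * k * k"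
      "\<bar>F x - h\<bar> \<le> \<delta> \<Longrightarrow> sqrt c\<^sub>1 \<le> norm (gradient F x)" "{x. F x \<ge> h - \<delta>} \<subseteq> ?B" if F: "F \<in> ?\<F>" for F x
    proof -
      obtain u where u: "u \<in> regular_masks R K J f \<phi> C" "F = intensity K J u"
        using F by blast
      show "GDERIV F x :> gradient F x" "norm (gradient F x) \<le> 2 * A * k * k"
        using grad(1,2)[OF reg[OF u(1)]] by (simp_all add: u(2) G_def)
      show "\<bar>F x - h\<bar> \<le> \<delta> \<Longrightarrow> sqrt c\<^sub>1 \<le> norm (gradient F x)"
        using nondeg[OF u(1)] by (simp add: u(2) G_def)
      have "ball 0 R\<^sub>1 \<subseteq> ?B"
        by (rule subset_ball) simp
      then show "{x. F x \<ge> h - \<delta>} \<subseteq> ?B"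
        using assms(28)[OF reg[OF u(1)]] by (simp add: u(2) subset_trans)
    qed
    have equi: "\<exists>\<rho>>0. \<forall>F\<in>?\<F>. \<forall>x y. norm (x - y) \<le> \<rho> \<longrightarrow> norm (gradient F x - gradient F y) \<le> \<kappa>"
      if \<kappa>: "0 < \<kappa>" for \<kappa>
    proof -
      obtain \<rho> where "\<rho> > 0" "\<forall>u\<in>masks R. \<forall>x y. norm (x - y) \<le> \<rho> \<longrightarrow> norm (G u x - G u y) \<le> \<kappa>"
        using modulus[OF \<kappa>] by blast
      then show ?thesis
        using reg by (intro exI[of _ \<rho>]) (auto simp: G_def)
    qed
    have c: "0 < sqrt c\<^sub>1"
      using \<open>c\<^sub>1 > 0\<close> by simp
    note st = superlevel_sets_strictly_stable[where \<F>="?\<F>", OF F(1,2) equi \<open>\<delta> > 0\<close> c \<open>a > 0\<close> F(3,4) bounded_ball open_ball]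
    show "\<forall>F\<in>?\<F>. indicator {x. F x > h} \<in> BV ?B"
      by (rule st(1))
    show "\<forall>\<epsilon>>0. \<exists>d>0. \<forall>F1\<in>?\<F>. \<forall>F2\<in>?\<F>. (\<forall>x. \<bar>F1 x - F2 x\<bar> \<le> d) \<longrightarrow>
        d_st a ?B (indicator {x. F1 x > h}) (indicator {x. F2 x > h}) < \<epsilon>"
      by (rule st(2))
  qed
  have wafer: "wafer K J h u = indicator {x. intensity K J u x > h}" for u
    by (simp add: wafer_def exposed_def)
  define B where "B = M * (N + N) * k\<^sup>2"
  have B: "0 \<le> B"
    using M N by (simp add: B_def)
  have close: "\<bar>intensity K J u x - intensity K J v x\<bar> \<le> B * L1_dist u v"
    if u: "u \<in> masks R" and v: "v \<in> masks R" for u v x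
  proof -
    note mu = masks_integral_bound[OF u, folded N_def] and mv = masks_integral_bound[OF v, folded N_def]
    have "\<bar>intensity K J u x - intensity K J v x\<bar>
        \<le> M * ((LINT \<xi>|lebesgue. \<bar>u \<xi>\<bar>) + (LINT \<xi>|lebesgue. \<bar>v \<xi>\<bar>)) * (norm (T x))\<^sup>2 * L1_dist u v"
      using imaging_form_diff_mask[OF cJ bJ mu(1) mv(1), of "T x"] by (simp add: int_eq L1_dist_def)
    also have "\<dots> \<le> B * L1_dist u v"
      unfolding B_def using M N mu(2) mv(2) T(2)
      by (intro mult_right_mono mult_mono mult_left_mono add_mono power_mono)
        (auto simp: L1_dist_def intro!: mult_nonneg_nonneg add_nonneg_nonneg)
    finally show ?thesis .
  qed
  show ?thesis
  proof (intro conjI allI impI)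
    show "\<forall>u\<in>regular_masks R K J f \<phi> C. wafer K J h u \<in> BV ?B"
      using stable(1) by (simp add: wafer)
  next
    fix \<epsilon> :: real assume "\<epsilon> > 0"
    then obtain d where d: "d > 0" "\<And>F1 F2. F1 \<in> ?\<F> \<Longrightarrow> F2 \<in> ?\<F> \<Longrightarrow> (\<And>x. \<bar>F1 x - F2 x\<bar> \<le> d) \<Longrightarrow>
        d_st a ?B (indicator {x. F1 x > h}) (indicator {x. F2 x > h}) < \<epsilon>"
      using stable(2) by meson
    have "d_st a ?B (wafer K J h u) (wafer K J h v) < \<epsilon>"
      if u: "u \<in> regular_masks R K J f \<phi> C" and v: "v \<in> regular_masks R K J f \<phi> C"
        and uv: "L1_dist u v < d / (B + 1)" for u v
      unfolding wafer
    proof (rule d(2))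
      fix x
      have "\<bar>intensity K J u x - intensity K J v x\<bar> \<le> B * L1_dist u v"
        by (rule close[OF reg[OF u] reg[OF v]])
      also have "\<dots> \<le> (B + 1) * L1_dist u v"
        by (intro mult_right_mono) (simp_all add: L1_dist_def)
      also have "\<dots> \<le> d"
        using uv B by (simp add: pos_less_divide_eq mult.commute)
      finally show "\<bar>intensity K J u x - intensity K J v x\<bar> \<le> d" .
    qed (use u v in auto)
    then show "\<exists>d>0. \<forall>u\<in>regular_masks R K J f \<phi> C. \<forall>v\<in>regular_masks R K J f \<phi> C.
        L1_dist u v < d \<longrightarrow> d_st a ?B (wafer K J h u) (wafer K J h v) < \<epsilon>"
      using d(1) B by (intro exI[of _ "d / (B + 1)"]) auto
  qed
qed

end
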